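(* Let $k$ be a $\sigma$-field, let $X$ be an irreducible affine $k$-$P[\sigma]$-variety, and let $T\subseteq X$ be an open subset which is a $\sigma$-torus such that the group action of $T$ on itself extends to a $\sigma$-algebraic group action of $T$ on $X$. Then there is an affine $P[x]$-semimodule $S$ and an isomorphism $X\simeq\mathrm{Spec}^{P[\sigma]}(k[S])$. In other words, $X$ is an affine toric $P[\sigma]$-variety.
   Context: All $\sigma$-fields (fields with a ring endomorphism $\sigma$) have characteristic $0$. $P[x]=\{f\in\mathbb{Z}[x]: f=0$ or the leading coefficient of $f$ is positive$\}$, $P[x]^*=P[x]\setminus\{0\}$. For $a\ne0$ in a $\sigma$-field and $g=\sum c_ix^i\in\mathbb{Z}[x]$, $a^g=\prod_i\sigma^i(a)^{c_i}$; $0^g=0$ for $g\in P[x]^*$; $a^0=1$. $k\{y_1,\dots,y_m\}^{P[\sigma]}$ is the $k$-algebra with $k$-basis the monomials $\mathbb{Y}^{\mathbf u}=\prod y_i^{u_i}$, $\mathbf u\in P[x]^m$, with $\mathbb{Y}^{\mathbf u}\mathbb{Y}^{\mathbf v}=\mathbb{Y}^{\mathbf u+\mathbf v}$ and $\sigma(\mathbb{Y}^{\mathbf u})=\mathbb{Y}^{x\mathbf u}$ (extending $\sigma$ on $k$). A $P[\sigma]$-term is $c\,\mathbb{Y}^{\mathbf u}$, $c\in k$. An affine $k$-$P[\sigma]$-variety $X\subseteq\mathbb{A}^m$ is a functor $K\mapsto\{a\in K^m: f(a)=0\ \forall f\in F\}$ on $\sigma$-field extensions $K$ of $k$; $\mathbb{I}(X)$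 is its vanishing ideal and $k\{X\}=k\{y_1,\dots,y_m\}^{P[\sigma]}/\mathbb{I}(X)$ its coordinate ring. Morphisms of affine $k$-$P[\sigma]$-varieties are morphisms of functors given by tuples of $P[\sigma]$-terms; they correspond contravariantly to $k$-$\sigma$-algebra homomorphisms of coordinate rings sending (images of) $P[\sigma]$-terms to (images of) $P[\sigma]$-terms. $X\simeq\mathrm{Spec}^{P[\sigma]}(R)$ means $k\{X\}\simeq R$ in this sense. In $k\{y_1,\dots,y_m\}^{P[\sigma]}$, a $\sigma$-ideal $I$ (an ideal with $\sigma(I)\subseteq I$) is $P[\sigma]$-prime if it is prime, perfect ($a^g\in I$, $g\in\mathbb{N}[x]\setminus\{0\}$, implies $a\in I$) and a $P[\sigma]$-ideal ($\mathbb{Y}^{\mathbf u}f\in I$ implies $\mathbb{Y}^{g\mathbf u}f\in I$ for all $g\in P[x]^*$); in quotients the notion is defined via preimages. The topological space of $X$ is the set of $P[\sigma]$-prime ideals of $k\{X\}$ with closed sets $\{\mathfrak p\supseteq F\}$; open and irreducible refer to this topology. A $\mathbb{Z}[x]$-lattice is a $\mathbb{Z}[x]$-module embeddable in some $\mathbb{Z}[x]^n$. A $\sigma$-torus is an affine variety $T\simeq\mathrm{Spec}^{P[\sigma]}(k[M])$ for a $\mathbb{Z}[x]$-lattice $M$, where $k[M]=\bigoplus_{\mathbf u\in M}k\chi^{\mathbf u}$, $\chi^{\mathbf u}\chi^{\mathbf v}=\chi^{\mathbf u+\mathbf v}$, $\sigma(\chi^{\mathbf u})=\chi^{x\mathbf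 u}$; so $T(K)=\mathrm{Hom}_{\mathbb{Z}[x]}(M,K^* )$ with $\mathbb{Z}[x]$ acting on $K^*$ by $a\mapsto a^g$, a group under pointwise multiplication. The inclusion $T\subseteq X$ is a morphism, and a $\sigma$-algebraic group action of $T$ on $X$ is a morphism $T\times X\to X$ (the coordinate ring of $T\times X$ being $k[M]\otimes_kk\{X\}$) inducing group actions on $K$-points for all $K$. A $P[x]$-semimodule is a subset $S\subseteq\mathbb{Z}[x]^n$ closed under addition and multiplication by elements of $P[x]$; it is affine if $S=\{\sum g_i\mathbf u_i: g_i\in P[x]\}$ for some finite subset $\{\mathbf u_1,\dots,\mathbf u_m\}$. $k[S]=\bigoplus_{\mathbf u\in S}k\chi^{\mathbf u}$ with the same operations. *)

theory Defs
  imports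
    "HOL-Algebra.Algebraic_Closure_Type"
    "HOL-Algebra.Group_Action"
    "HOL-Algebra.QuotRing"
    "HOL-Analysis.Abstract_Topology"
    "HOL-Library.Poly_Mapping"
begin

text \<open>
  The base field \<open>k\<close> is a type \<open>'k\<close> of class \<^class>\<open>field_char_0\<close> together with a ring
  endomorphism \<open>\<sigma>\<close>. The type of finitely supported functions \<open>'m \<Rightarrow>\<^sub>0 'k\<close> on an
  additive monoid carries the convolution product, i.e. it is the monoid algebra, with
  \<open>Poly_Mapping.single u c\<close> for \<open>c \<chi>\<^sup>u\<close>. Rings varying inside a statement (extension
  fields, coordinate rings) are records with carriers.
\<close>

definition sigma_field :: "('k::field_char_0 \<Rightarrow> 'k) \<Rightarrow> bool" where
  "sigma_field \<sigma> \<longleftrightarrow> \<sigma> \<in> ring_hom ring_of_type_algebra ring_of_type_algebra"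

record ('a, 'k) sigma_algebra = "'a ring" +
  sig :: "'a \<Rightarrow> 'a"
  smap :: "'k \<Rightarrow> 'a"

text \<open>
  A \<open>k\<close>-\<open>\<sigma>\<close>-algebra with a distinguished set of elements, the (images of) \<open>P[\<sigma>]\<close>-terms.
\<close>

record ('a, 'k) psigma_algebra = "('a, 'k) sigma_algebra" +
  terms :: "'a set"

definition psigma_hom ::
  "('a, 'k) psigma_algebra \<Rightarrow> ('b, 'k) psigma_algebra \<Rightarrow> ('a \<Rightarrow> 'b) \<Rightarrow> bool" where
  "psigma_hom A B h \<longleftrightarrow>
     h \<in> ring_hom A B \<and>
     (\<forall>a\<in>carrier A. h (sig A a) = sig B (h a)) \<and>
     (\<forall>c. h (smap A c) = smap B c) \<and>
     h ` terms A \<subseteq> terms B"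

definition psigma_iso ::
  "('a, 'k) psigma_algebra \<Rightarrow> ('b, 'k) psigma_algebra \<Rightarrow> ('a \<Rightarrow> 'b) \<Rightarrow> bool" where
  "psigma_iso A B h \<longleftrightarrow>
     psigma_hom A B h \<and> bij_betw h (carrier A) (carrier B) \<and>
     psigma_hom B A (inv_into (carrier A) h)"


section \<open>Exponents\<close>

definition Px :: "int poly set" where
  "Px = {f. f = 0 \<or> lead_coeff f > 0}"

text \<open>
  \<open>\<int>[x]\<^sup>n\<close> is the set of maps \<open>nat \<Rightarrow>\<^sub>0 int poly\<close> supported in \<open>{..<n}\<close>.
\<close>

definition Zx_pow :: "nat \<Rightarrow> (nat \<Rightarrow>\<^sub>0 int poly) set" where
  "Zx_pow n = {u. Poly_Mapping.keys u \<subseteq> {..<n}}"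

definition Px_pow :: "nat \<Rightarrow> (nat \<Rightarrow>\<^sub>0 int poly) set" where
  "Px_pow n = {u \<in> Zx_pow n. \<forall>i. Poly_Mapping.lookup u i \<in> Px}"

definition Zx_scale :: "int poly \<Rightarrow> (nat \<Rightarrow>\<^sub>0 int poly) \<Rightarrow> (nat \<Rightarrow>\<^sub>0 int poly)" where
  "Zx_scale g u = Poly_Mapping.map (\<lambda>f. g * f) u"

lemma lookup_Zx_scale: "Poly_Mapping.lookup (Zx_scale g u) i = g * Poly_Mapping.lookup u i"
  by (simp add: Zx_scale_def Poly_Mapping.map.rep_eq when_def)

lemma module_Zx_scale: "Modules.module Zx_scale"
  by unfold_locales (auto intro!: poly_mapping_eqI simp: lookup_Zx_scale lookup_add algebra_simps)

text \<open>
  A lattice is a submodule \<open>M\<close> of an ambient \<open>\<int>[x]\<close>-module of type \<open>'m\<close> (possibly all of it)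
  that embeds into some \<open>\<int>[x]\<^sup>n\<close>.
\<close>

definition Zx_lattice :: "(int poly \<Rightarrow> 'm::ab_group_add \<Rightarrow> 'm) \<Rightarrow> 'm set \<Rightarrow> bool" where
  "Zx_lattice scale M \<longleftrightarrow>
     Modules.module scale \<and> Modules.module.subspace scale M \<and>
     (\<exists>n e. inj_on e M \<and> e ` M \<subseteq> Zx_pow n \<and>
        (\<forall>u\<in>M. \<forall>v\<in>M. e (u + v) = e u + e v) \<and>
        (\<forall>g. \<forall>u\<in>M. e (scale g u) = Zx_scale g (e u)))"

definition Px_semimodule :: "nat \<Rightarrow> (nat \<Rightarrow>\<^sub>0 int poly) set \<Rightarrow> bool" where
  "Px_semimodule n S \<longleftrightarrow>
     S \<subseteq> Zx_pow n \<and> (\<forall>u\<in>S. \<forall>v\<in>S. u + v \<in> S) \<and> (\<forall>g\<in>Px. \<forall>u\<in>S. Zx_scale g u \<in> S)"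

definition affine_Px_semimodule :: "nat \<Rightarrow> (nat \<Rightarrow>\<^sub>0 int poly) set \<Rightarrow> bool" where
  "affine_Px_semimodule n S \<longleftrightarrow>
     Px_semimodule n S \<and>
     (\<exists>U. finite U \<and> U \<subseteq> Zx_pow n \<and> S = {\<Sum>u\<in>U. Zx_scale (g u) u | g. g ` U \<subseteq> Px})"


section \<open>Monoid algebras\<close>

text \<open>
  The algebra \<open>k[S] = \<Oplus>\<^bsub>u\<in>S\<^esub> k \<chi>\<^sup>u\<close>; the polynomial variable \<open>x\<close> is \<open>[:0, 1:]\<close>.
  It serves for \<open>\<int>[x]\<close>-lattices, for \<open>P[x]\<close>-semimodules, and (with \<open>S = P[x]\<^sup>m\<close>)
  for \<open>k{y\<^sub>1,\<dots>,y\<^sub>m}\<close>.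
\<close>

definition monoid_algebra ::
  "('k::field_char_0 \<Rightarrow> 'k) \<Rightarrow> (int poly \<Rightarrow> 'm::comm_monoid_add \<Rightarrow> 'm) \<Rightarrow> 'm set
    \<Rightarrow> ('m \<Rightarrow>\<^sub>0 'k, 'k) psigma_algebra" where
  "monoid_algebra \<sigma> scale S =
     \<lparr>carrier = {f. Poly_Mapping.keys f \<subseteq> S}, monoid.mult = (*), one = 1, zero = 0, add = (+),
      sig = (\<lambda>f. \<Sum>u\<in>Poly_Mapping.keys f.
               Poly_Mapping.single (scale [:0, 1:] u) (\<sigma> (Poly_Mapping.lookup f u))),
      smap = (\<lambda>c. Poly_Mapping.single 0 c),
      terms = {Poly_Mapping.single u c | u c. u \<in> S}\<rparr>"

definition psigma_poly ::
  "('k::field_char_0 \<Rightarrow> 'k) \<Rightarrow> nat \<Rightarrow> ((nat \<Rightarrow>\<^sub>0 int poly) \<Rightarrow>\<^sub>0 'k, 'k) psigma_algebra" where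
  "psigma_poly \<sigma> m = monoid_algebra \<sigma> Zx_scale (Px_pow m)"


section \<open>Extension fields and evaluation\<close>

text \<open>
  \<open>\<sigma>\<close>-field extensions of \<open>k\<close> have their carrier inside a universe type \<open>'u\<close>, which stays a
  type variable throughout. An extension exists only if \<open>'u\<close> is at least as large as
  \<open>k\<close>; then \<open>'u\<close> contains, up to isomorphism, every extension generated over \<open>k\<close> by
  countably many elements (\<open>k\<close> is infinite), so that vanishing ideals do not depend on \<open>'u\<close>.
\<close>

definition sigma_field_ext ::
  "('k::field_char_0 \<Rightarrow> 'k) \<Rightarrow> ('u, 'k) sigma_algebra \<Rightarrow> bool" where
  "sigma_field_ext \<sigma> K \<longleftrightarrow>
     field K \<and> sig K \<in> ring_hom K K \<and> smap K \<in> ring_hom ring_of_type_algebra K \<and>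
     (\<forall>c. smap K (\<sigma> c) = sig K (smap K c))"

text \<open>The power \<open>a\<^sup>g\<close>; for \<open>a = 0\<close> only \<open>g \<in> P[x]\<close> is meaningful.\<close>

definition Zx_power :: "('u, 'k) sigma_algebra \<Rightarrow> 'u \<Rightarrow> int poly \<Rightarrow> 'u" where
  "Zx_power K a g =
     (if g = 0 then \<one>\<^bsub>K\<^esub>
      else if a = \<zero>\<^bsub>K\<^esub> then \<zero>\<^bsub>K\<^esub>
      else finprod K (\<lambda>i. (sig K ^^ i) a [^]\<^bsub>K\<^esub> Polynomial.coeff g i) {..Polynomial.degree g})"

definition eval_mono :: "('u, 'k) sigma_algebra \<Rightarrow> (nat \<Rightarrow> 'u) \<Rightarrow> (nat \<Rightarrow>\<^sub>0 int poly) \<Rightarrow> 'u" where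
  "eval_mono K a u =
     finprod K (\<lambda>i. Zx_power K (a i) (Poly_Mapping.lookup u i)) (Poly_Mapping.keys u)"

definition eval_psigma ::
  "('u, 'k::field_char_0) sigma_algebra \<Rightarrow> (nat \<Rightarrow> 'u) \<Rightarrow> ((nat \<Rightarrow>\<^sub>0 int poly) \<Rightarrow>\<^sub>0 'k) \<Rightarrow> 'u" where
  "eval_psigma K a f =
     finsum K (\<lambda>u. smap K (Poly_Mapping.lookup f u) \<otimes>\<^bsub>K\<^esub> eval_mono K a u) (Poly_Mapping.keys f)"


section \<open>Affine varieties and coordinate rings\<close>

type_synonym ('u, 'k) point_functor = "('u, 'k) sigma_algebra \<Rightarrow> (nat \<Rightarrow> 'u) set"

text \<open>Functors of points are empty on records that are not \<open>\<sigma>\<close>-field extensions of \<open>k\<close>.\<close>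

definition zero_functor ::
  "('k::field_char_0 \<Rightarrow> 'k) \<Rightarrow> nat \<Rightarrow> ((nat \<Rightarrow>\<^sub>0 int poly) \<Rightarrow>\<^sub>0 'k) set \<Rightarrow> ('u, 'k) point_functor" where
  "zero_functor \<sigma> m F K =
     {a \<in> {..<m} \<rightarrow>\<^sub>E carrier K. sigma_field_ext \<sigma> K \<and> (\<forall>f\<in>F. eval_psigma K a f = \<zero>\<^bsub>K\<^esub>)}"

definition affine_psigma_variety ::
  "('k::field_char_0 \<Rightarrow> 'k) \<Rightarrow> nat \<Rightarrow> ('u, 'k) point_functor \<Rightarrow> bool" where
  "affine_psigma_variety \<sigma> m V \<longleftrightarrow>
     (\<exists>F. F \<subseteq> carrier (psigma_poly \<sigma> m) \<and> V = zero_functor \<sigma> m F)"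

definition vanishing_ideal ::
  "('k::field_char_0 \<Rightarrow> 'k) \<Rightarrow> nat \<Rightarrow> ('u, 'k) point_functor \<Rightarrow> ((nat \<Rightarrow>\<^sub>0 int poly) \<Rightarrow>\<^sub>0 'k) set" where
  "vanishing_ideal \<sigma> m V =
     {f \<in> carrier (psigma_poly \<sigma> m).
        \<forall>K. sigma_field_ext \<sigma> K \<longrightarrow> (\<forall>a\<in>V K. eval_psigma K a f = \<zero>\<^bsub>K\<^esub>)}"

definition psigma_quotient ::
  "('a, 'k) psigma_algebra \<Rightarrow> 'a set \<Rightarrow> ('a set, 'k) psigma_algebra" where
  "psigma_quotient R I =
     \<lparr>carrier = carrier (R Quot I), monoid.mult = monoid.mult (R Quot I), one = \<one>\<^bsub>R Quot I\<^esub>,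
      zero = \<zero>\<^bsub>R Quot I\<^esub>, add = ring.add (R Quot I),
      sig = (\<lambda>C. \<Union>f\<in>C. I +>\<^bsub>R\<^esub> sig R f),
      smap = (\<lambda>c. I +>\<^bsub>R\<^esub> smap R c),
      terms = {I +>\<^bsub>R\<^esub> t | t. t \<in> terms R}\<rparr>"

definition coord_ring ::
  "('k::field_char_0 \<Rightarrow> 'k) \<Rightarrow> nat \<Rightarrow> ('u, 'k) point_functor
    \<Rightarrow> (((nat \<Rightarrow>\<^sub>0 int poly) \<Rightarrow>\<^sub>0 'k) set, 'k) psigma_algebra" where
  "coord_ring \<sigma> m V = psigma_quotient (psigma_poly \<sigma> m) (vanishing_ideal \<sigma> m V)"

text \<open>
  Elements of \<open>k{V}\<close> are cosets of \<open>\<I>(V)\<close>; at a point of \<open>V\<close> all members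
  of a coset have the same value.
\<close>

definition eval_coord ::
  "('u, 'k::field_char_0) sigma_algebra \<Rightarrow> (nat \<Rightarrow> 'u) \<Rightarrow> ((nat \<Rightarrow>\<^sub>0 int poly) \<Rightarrow>\<^sub>0 'k) set \<Rightarrow> 'u" where
  "eval_coord K a C = the_elem (eval_psigma K a ` C)"


section \<open>The topological space of a variety\<close>

text \<open>The power \<open>a\<^sup>g\<close> in a \<open>\<sigma>\<close>-ring for \<open>g \<in> \<nat>[x]\<close>.\<close>

definition Nx_power :: "('a, 'k) psigma_algebra \<Rightarrow> 'a \<Rightarrow> nat poly \<Rightarrow> 'a" where
  "Nx_power R a g =
     finprod R (\<lambda>i. (sig R ^^ i) a [^]\<^bsub>R\<^esub> Polynomial.coeff g i) {..Polynomial.degree g}"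

definition psigma_prime ::
  "('k::field_char_0 \<Rightarrow> 'k) \<Rightarrow> nat \<Rightarrow> ((nat \<Rightarrow>\<^sub>0 int poly) \<Rightarrow>\<^sub>0 'k) set \<Rightarrow> bool" where
  "psigma_prime \<sigma> m I \<longleftrightarrow>
     primeideal I (psigma_poly \<sigma> m) \<and>
     sig (psigma_poly \<sigma> m) ` I \<subseteq> I \<and>
     (\<forall>a\<in>carrier (psigma_poly \<sigma> m). \<forall>g. g \<noteq> 0 \<longrightarrow>
        Nx_power (psigma_poly \<sigma> m) a g \<in> I \<longrightarrow> a \<in> I) \<and>
     (\<forall>u\<in>Px_pow m. \<forall>f\<in>carrier (psigma_poly \<sigma> m).
        Poly_Mapping.single u 1 * f \<in> I \<longrightarrow>
        (\<forall>g\<in>Px - {0}. Poly_Mapping.single (Zx_scale g u) 1 * f \<in> I))"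

definition psigma_spectrum ::
  "('k::field_char_0 \<Rightarrow> 'k) \<Rightarrow> nat \<Rightarrow> ('u, 'k) point_functor
    \<Rightarrow> ((nat \<Rightarrow>\<^sub>0 int poly) \<Rightarrow>\<^sub>0 'k) set set set" where
  "psigma_spectrum \<sigma> m V =
     {p. p \<subseteq> carrier (coord_ring \<sigma> m V) \<and>
         psigma_prime \<sigma> m
           {f \<in> carrier (psigma_poly \<sigma> m).
              vanishing_ideal \<sigma> m V +>\<^bsub>psigma_poly \<sigma> m\<^esub> f \<in> p}}"

definition psigma_space ::
  "('k::field_char_0 \<Rightarrow> 'k) \<Rightarrow> nat \<Rightarrow> ('u, 'k) point_functor
    \<Rightarrow> ((nat \<Rightarrow>\<^sub>0 int poly) \<Rightarrow>\<^sub>0 'k) set set topology" where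
  "psigma_space \<sigma> m V =
     topology (\<lambda>U. \<exists>F. F \<subseteq> carrier (coord_ring \<sigma> m V) \<and>
                     U = psigma_spectrum \<sigma> m V - {p \<in> psigma_spectrum \<sigma> m V. F \<subseteq> p})"

definition irreducible_space :: "'a topology \<Rightarrow> bool" where
  "irreducible_space Y \<longleftrightarrow>
     topspace Y \<noteq> {} \<and>
     (\<forall>A B. closedin Y A \<longrightarrow> closedin Y B \<longrightarrow> topspace Y = A \<union> B \<longrightarrow>
        A = topspace Y \<or> B = topspace Y)"


section \<open>Morphisms\<close>

definition eval_tuple ::
  "nat \<Rightarrow> (nat \<Rightarrow> (nat \<Rightarrow>\<^sub>0 int poly) \<Rightarrow>\<^sub>0 'k::field_char_0)
    \<Rightarrow> ('u, 'k) sigma_algebra \<Rightarrow> (nat \<Rightarrow> 'u) \<Rightarrow> (nat \<Rightarrow> 'u)" where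
  "eval_tuple m s K a = (\<lambda>i\<in>{..<m}. eval_psigma K a (s i))"

text \<open>
  A morphism from \<open>V \<subseteq> \<A>\<^sup>n\<close> to \<open>Y \<subseteq> \<A>\<^sup>m\<close> given by an \<open>m\<close>-tuple \<open>s\<close> of terms in \<open>n\<close> variables.
\<close>

definition psigma_morphism ::
  "('k::field_char_0 \<Rightarrow> 'k) \<Rightarrow> nat \<Rightarrow> ('u, 'k) point_functor \<Rightarrow> nat \<Rightarrow> ('u, 'k) point_functor
    \<Rightarrow> (nat \<Rightarrow> (nat \<Rightarrow>\<^sub>0 int poly) \<Rightarrow>\<^sub>0 'k) \<Rightarrow> bool" where
  "psigma_morphism \<sigma> n V m Y s \<longleftrightarrow>
     (\<forall>i<m. s i \<in> terms (psigma_poly \<sigma> n)) \<and>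
     (\<forall>K. sigma_field_ext \<sigma> K \<longrightarrow> (\<forall>a\<in>V K. eval_tuple m s K a \<in> Y K))"

text \<open>
  The dual homomorphism \<open>k{Y} \<rightarrow> k{V}\<close> is composition of functions with the morphism; an
  element of \<open>k{V}\<close> is determined by its values at all points of \<open>V\<close>.
\<close>

definition comorphism ::
  "('k::field_char_0 \<Rightarrow> 'k) \<Rightarrow> nat \<Rightarrow> ('u, 'k) point_functor \<Rightarrow> nat
    \<Rightarrow> (nat \<Rightarrow> (nat \<Rightarrow>\<^sub>0 int poly) \<Rightarrow>\<^sub>0 'k)
    \<Rightarrow> ((nat \<Rightarrow>\<^sub>0 int poly) \<Rightarrow>\<^sub>0 'k) set \<Rightarrow> ((nat \<Rightarrow>\<^sub>0 int poly) \<Rightarrow>\<^sub>0 'k) set" where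
  "comorphism \<sigma> n V m s C =
     (THE D. D \<in> carrier (coord_ring \<sigma> n V) \<and>
        (\<forall>K. sigma_field_ext \<sigma> K \<longrightarrow>
           (\<forall>a\<in>V K. eval_coord K a D = eval_coord K (eval_tuple m s K a) C)))"

definition spectrum_map ::
  "('k::field_char_0 \<Rightarrow> 'k) \<Rightarrow> nat \<Rightarrow> ('u, 'k) point_functor \<Rightarrow> nat \<Rightarrow> ('u, 'k) point_functor
    \<Rightarrow> (nat \<Rightarrow> (nat \<Rightarrow>\<^sub>0 int poly) \<Rightarrow>\<^sub>0 'k)
    \<Rightarrow> ((nat \<Rightarrow>\<^sub>0 int poly) \<Rightarrow>\<^sub>0 'k) set set \<Rightarrow> ((nat \<Rightarrow>\<^sub>0 int poly) \<Rightarrow>\<^sub>0 'k) set set" where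
  "spectrum_map \<sigma> n V m Y s p =
     {C \<in> carrier (coord_ring \<sigma> m Y). comorphism \<sigma> n V m s C \<in> p}"

text \<open>
  The morphism \<open>s\<close> identifies \<open>V\<close> with an open subset of \<open>Y\<close>: it is injective on
  points, and on topological spaces it is a homeomorphism onto an open subset.
\<close>

definition open_inclusion ::
  "('k::field_char_0 \<Rightarrow> 'k) \<Rightarrow> nat \<Rightarrow> ('u, 'k) point_functor \<Rightarrow> nat \<Rightarrow> ('u, 'k) point_functor
    \<Rightarrow> (nat \<Rightarrow> (nat \<Rightarrow>\<^sub>0 int poly) \<Rightarrow>\<^sub>0 'k) \<Rightarrow> bool" where
  "open_inclusion \<sigma> n V m Y s \<longleftrightarrow>
     psigma_morphism \<sigma> n V m Y s \<and>
     (\<forall>K. sigma_field_ext \<sigma> K \<longrightarrow> inj_on (eval_tuple m s K) (V K)) \<and>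
     embedding_map (psigma_space \<sigma> n V) (psigma_space \<sigma> m Y) (spectrum_map \<sigma> n V m Y s) \<and>
     openin (psigma_space \<sigma> m Y) (spectrum_map \<sigma> n V m Y s ` topspace (psigma_space \<sigma> n V))"

text \<open>
  Products: the first \<open>n\<close> coordinates belong to \<open>V \<subseteq> \<A>\<^sup>n\<close>, the next \<open>m\<close> to \<open>Y \<subseteq> \<A>\<^sup>m\<close>.
\<close>

definition join_points :: "nat \<Rightarrow> nat \<Rightarrow> (nat \<Rightarrow> 'u) \<Rightarrow> (nat \<Rightarrow> 'u) \<Rightarrow> (nat \<Rightarrow> 'u)" where
  "join_points n m b a = (\<lambda>i\<in>{..<n + m}. if i < n then b i else a (i - n))"

definition prod_functor ::
  "nat \<Rightarrow> ('u, 'k) point_functor \<Rightarrow> nat \<Rightarrow> ('u, 'k) point_functor \<Rightarrow> ('u, 'k) point_functor" where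
  "prod_functor n V m Y K = {join_points n m b a | b a. b \<in> V K \<and> a \<in> Y K}"


section \<open>Tori and their actions\<close>

text \<open>
  A torus \<open>T \<subseteq> \<A>\<^sup>n\<close> comes with a lattice \<open>M\<close> and an isomorphism \<open>\<theta> : k[M] \<rightarrow> k{T}\<close>; the latter
  determines the bijection \<open>T(K) \<rightarrow> Hom(M, K\<^sup>*)\<close>, \<open>b \<mapsto> (u \<mapsto> \<chi>\<^sup>u(b))\<close>, and so the group structure.
\<close>

definition sigma_torus ::
  "('k::field_char_0 \<Rightarrow> 'k) \<Rightarrow> nat \<Rightarrow> ('u, 'k) point_functor
    \<Rightarrow> (int poly \<Rightarrow> 'm::ab_group_add \<Rightarrow> 'm) \<Rightarrow> 'm set
    \<Rightarrow> (('m \<Rightarrow>\<^sub>0 'k) \<Rightarrow> ((nat \<Rightarrow>\<^sub>0 int poly) \<Rightarrow>\<^sub>0 'k) set) \<Rightarrow> bool" where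
  "sigma_torus \<sigma> n T scale M \<theta> \<longleftrightarrow>
     affine_psigma_variety \<sigma> n T \<and> Zx_lattice scale M \<and>
     psigma_iso (monoid_algebra \<sigma> scale M) (coord_ring \<sigma> n T) \<theta>"

definition torus_char ::
  "(('m \<Rightarrow>\<^sub>0 'k::field_char_0) \<Rightarrow> ((nat \<Rightarrow>\<^sub>0 int poly) \<Rightarrow>\<^sub>0 'k) set)
    \<Rightarrow> ('u, 'k) sigma_algebra \<Rightarrow> 'm \<Rightarrow> (nat \<Rightarrow> 'u) \<Rightarrow> 'u" where
  "torus_char \<theta> K u b = eval_coord K b (\<theta> (Poly_Mapping.single u 1))"

definition torus_group ::
  "('u, 'k::field_char_0) point_functor \<Rightarrow> 'm set
    \<Rightarrow> (('m \<Rightarrow>\<^sub>0 'k) \<Rightarrow> ((nat \<Rightarrow>\<^sub>0 int poly) \<Rightarrow>\<^sub>0 'k) set)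
    \<Rightarrow> ('u, 'k) sigma_algebra \<Rightarrow> (nat \<Rightarrow> 'u) monoid" where
  "torus_group T M \<theta> K =
     \<lparr>carrier = T K,
      monoid.mult = (\<lambda>b b'. THE c. c \<in> T K \<and>
        (\<forall>u\<in>M. torus_char \<theta> K u c = torus_char \<theta> K u b \<otimes>\<^bsub>K\<^esub> torus_char \<theta> K u b')),
      one = (THE c. c \<in> T K \<and> (\<forall>u\<in>M. torus_char \<theta> K u c = \<one>\<^bsub>K\<^esub>))\<rparr>"

definition sigma_algebraic_action ::
  "('k::field_char_0 \<Rightarrow> 'k) \<Rightarrow> nat \<Rightarrow> ('u, 'k) point_functor \<Rightarrow> 'm set
    \<Rightarrow> (('m \<Rightarrow>\<^sub>0 'k) \<Rightarrow> ((nat \<Rightarrow>\<^sub>0 int poly) \<Rightarrow>\<^sub>0 'k) set)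
    \<Rightarrow> nat \<Rightarrow> ('u, 'k) point_functor \<Rightarrow> (nat \<Rightarrow> (nat \<Rightarrow>\<^sub>0 int poly) \<Rightarrow>\<^sub>0 'k) \<Rightarrow> bool" where
  "sigma_algebraic_action \<sigma> n T M \<theta> m V t \<longleftrightarrow>
     psigma_morphism \<sigma> (n + m) (prod_functor n T m V) m V t \<and>
     (\<forall>K. sigma_field_ext \<sigma> K \<longrightarrow>
        group_action (torus_group T M \<theta> K) (V K)
          (\<lambda>b. \<lambda>a\<in>V K. eval_tuple m t K (join_points n m b a)))"

text \<open>The action \<open>t\<close> on \<open>V\<close> extends the translation action of \<open>T\<close> on itself, \<open>s : T \<rightarrow> V\<close> being
  the inclusion.\<close>

definition extends_translation ::
  "('k::field_char_0 \<Rightarrow> 'k) \<Rightarrow> nat \<Rightarrow> ('u, 'k) point_functor \<Rightarrow> 'm set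
    \<Rightarrow> (('m \<Rightarrow>\<^sub>0 'k) \<Rightarrow> ((nat \<Rightarrow>\<^sub>0 int poly) \<Rightarrow>\<^sub>0 'k) set)
    \<Rightarrow> nat \<Rightarrow> (nat \<Rightarrow> (nat \<Rightarrow>\<^sub>0 int poly) \<Rightarrow>\<^sub>0 'k)
    \<Rightarrow> (nat \<Rightarrow> (nat \<Rightarrow>\<^sub>0 int poly) \<Rightarrow>\<^sub>0 'k) \<Rightarrow> bool" where
  "extends_translation \<sigma> n T M \<theta> m s t \<longleftrightarrow>
     (\<forall>K. sigma_field_ext \<sigma> K \<longrightarrow> (\<forall>b\<in>T K. \<forall>b'\<in>T K.
        eval_tuple m t K (join_points n m b (eval_tuple m s K b')) =
        eval_tuple m s K (b \<otimes>\<^bsub>torus_group T M \<theta> K\<^esub> b')))"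

end

theory Submission
  imports Defs
begin

text \<open>
  The inclusion of \<open>T\<close> is given by terms, so that in \<open>k{T} \<simeq> k[M]\<close> the coordinate \<open>y\<^sub>i\<close> of \<open>X\<close> becomes
  a single term \<open>d\<^sub>i \<chi>\<^bsup>w\<^sub>i\<^esup>\<close>, and \<open>Y\<^sup>u\<close> becomes \<open>d\<^sup>u \<chi>\<^bsup>\<Sum> u\<^sub>i w\<^sub>i\<^esup>\<close>. The image of \<open>k{y\<^sub>1,\<dots>,y\<^sub>m}\<close> is therefore
  \<open>k[S]\<close> with \<open>S\<close> generated by the \<open>w\<^sub>i\<close> with \<open>d\<^sub>i \<noteq> 0\<close>. The kernel consists of the functions
  vanishing on \<open>T\<close>. Such a function vanishes on \<open>X\<close>: the kernel of evaluation at a point is a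
  \<open>P[\<sigma>]\<close>-prime ideal, so the open subset \<open>T\<close> meets every nonempty basic open subset of the irreducible
  space of \<open>X\<close>.
\<close>

text \<open>Identities in k{X} and k{T} are tested at points, where they become identities in a
  field. There the formula for the image of Y^u rests on a rigidity: a map from Z[x] to the units of
  K that turns sums into products and multiplication by x into \<sigma> is determined by its value a
  at 1, hence is g |-> a^g. The base field is treated as an extension of itself, so that d^u in k
  and a^u in K are one notion.

  The obstacle is the value 0. A coordinate of X may vanish identically on T, which gives d_i = 0,
  and then powers cannot be computed in a group of units; 0^(g+h) = 0^g 0^h holds for g, h in P[x]
  only because leading terms cannot cancel there. Power laws are therefore proved for units and all
  of Z[x], and then for arbitrary elements and P[x].

  The open image of T must be nonempty, so T needs a point; one exists because 1 is nonzero in k[M]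
  and points separate the elements of k[M]. Finally M is an abstract module while S has to consist
  of tuples, so the w_i are replaced by their images under an embedding of M into some
  Z[x]^N.\<close>

locale sigma_ext = field K for K :: "('u, 'k::field_char_0) sigma_algebra" (structure) +
  fixes \<sigma> :: "'k \<Rightarrow> 'k"
  assumes ext: "sigma_field_ext \<sigma> K"
begin

lemma sig_hom: "ring_hom_cring K K (sig K)"
  using ext is_cring by (auto simp: ring_hom_cring_def ring_hom_cring_axioms_def sigma_field_ext_def)

sublocale sig: ring_hom_cring K K "sig K"
  by (rule sig_hom)

lemma smap_closed [simp]: "smap K c \<in> carrier K"
  and smap_add: "smap K (c + d) = smap K c \<oplus> smap K d"
  and smap_mult: "smap K (c * d) = smap K c \<otimes> smap K d"
  and smap_one [simp]: "smap K 1 = \<one>"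
  and sig_smap: "sig K (smap K c) = smap K (\<sigma> c)"
  using ext by (auto simp: sigma_field_ext_def ring_hom_def ring_of_type_algebra_def)

lemma smap_zero [simp]: "smap K 0 = \<zero>"
proof -
  have "smap K 0 \<oplus> smap K 0 = smap K 0 \<oplus> \<zero>"
    by (simp flip: smap_add)
  then show ?thesis
    using local.add.l_cancel by (metis smap_closed zero_closed)
qed

lemma nonzero_Units: "a \<in> Units K \<longleftrightarrow> a \<in> carrier K \<and> a \<noteq> \<zero>"
  by (simp add: field_Units)

text \<open>A ring endomorphism maps inverses to inverses, so it cannot kill a unit. This gives
  negative powers of \<sigma>^i(a) a meaning.\<close>

lemma sig_Units: "a \<in> Units K \<Longrightarrow> sig K a \<in> Units K"
proof -
  assume a: "a \<in> Units K"
  then have "sig K a \<otimes> sig K (inv a) = \<one>"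
    by (simp add: Units_closed flip: sig.hom_mult)
  then show ?thesis
    using a nonzero_Units by (metis Units_closed Units_inv_closed l_null sig.hom_closed zero_not_one)
qed

lemma sig_funpow_closed [simp]: "a \<in> carrier K \<Longrightarrow> (sig K ^^ i) a \<in> carrier K"
  by (induction i) auto

text \<open>Integer powers obey the usual laws only in a group, so the next lemmas are imported from
  \<open>units_of K\<close>.\<close>

lemma int_pow_units_of: "a \<in> Units K \<Longrightarrow> a [^] (z::int) = a [^]\<^bsub>units_of K\<^esub> z"
  unfolding int_pow_def2 by (simp add: units_of_pow units_of_inv Units_pow_closed del: pow_nat)

lemma int_pow_Units: "a \<in> Units K \<Longrightarrow> a [^] (z::int) \<in> Units K"
  using group.int_pow_closed[OF units_group, of a z] by (simp add: int_pow_units_of units_of_carrier)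

lemma int_pow_add: "a \<in> Units K \<Longrightarrow> a [^] (y + z::int) = a [^] y \<otimes> a [^] z"
  using group.int_pow_mult[OF units_group, of a y z]
  by (simp add: int_pow_units_of units_of_carrier units_of_mult)

lemma sig_int_pow: "a \<in> Units K \<Longrightarrow> sig K (a [^] (z::int)) = sig K a [^] z"
proof -
  assume a: "a \<in> Units K"
  have "sig K \<in> hom (units_of K) (units_of K)"
    by (auto simp: hom_def units_of_carrier units_of_mult sig_Units Units_closed)
  then show ?thesis
    using hom_int_pow[of "sig K" "units_of K" "units_of K" a z] a units_group
    by (simp add: int_pow_units_of units_of_carrier sig_Units)
qed

lemma sig_funpow_Units: "a \<in> Units K \<Longrightarrow> (sig K ^^ i) a \<in> Units K"
  by (induction i) (auto simp: sig_Units)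

lemma finprod_Units: "f \<in> A \<rightarrow> Units K \<Longrightarrow> finprod K f A \<in> Units K"
proof (induction A rule: infinite_finite_induct)
  case (insert x A)
  then show ?case
    by (subst finprod_insert) (auto simp: Pi_def)
qed auto

lemma finprod_eq_zero_iff:
  "finite A \<Longrightarrow> f \<in> A \<rightarrow> carrier K \<Longrightarrow> finprod K f A = \<zero> \<longleftrightarrow> (\<exists>x\<in>A. f x = \<zero>)"
proof (induction A rule: finite_induct)
  case (insert x A)
  then show ?case
    by (subst finprod_insert) (auto simp: Pi_def integral_iff)
qed auto

section \<open>Powers with exponents in the polynomial ring\<close>

lemma Zx_power_zero_exp [simp]: "Zx_power K a 0 = \<one>"
  by (simp add: Zx_power_def)

lemma Zx_power_zero_base: "Zx_power K \<zero> g = (if g = 0 then \<one> else \<zero>)"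
  by (simp add: Zx_power_def)

text \<open>Coefficients beyond the degree are 0 and contribute trivial factors. With a free common
  bound N, a drop of degree in g + h does no harm.\<close>

lemma Zx_power_eq_finprod:
  assumes a: "a \<in> Units K" and N: "Polynomial.degree g \<le> N"
  shows "Zx_power K a g = finprod K (\<lambda>i. (sig K ^^ i) a [^] Polynomial.coeff g i) {..N}"
proof -
  have cl: "(sig K ^^ i) a [^] (z::int) \<in> carrier K" for i z
    using int_pow_Units sig_funpow_Units a by blast
  have "finprod K (\<lambda>i. (sig K ^^ i) a [^] Polynomial.coeff g i) {..Polynomial.degree g} =
    finprod K (\<lambda>i. (sig K ^^ i) a [^] Polynomial.coeff g i) {..N}"
    using N cl by (intro finprod_mono_neutral_cong_left) (auto simp: coeff_eq_0 int_pow_0)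
  then show ?thesis
    using a by (auto simp: Zx_power_def nonzero_Units)
qed

lemma Zx_power_Units: "a \<in> Units K \<Longrightarrow> Zx_power K a g \<in> Units K"
  by (auto simp: Zx_power_eq_finprod[OF _ order_refl] intro!: finprod_Units int_pow_Units sig_funpow_Units)

lemma Zx_power_closed [simp]: "a \<in> carrier K \<Longrightarrow> Zx_power K a g \<in> carrier K"
  using Zx_power_Units[of a g] by (cases "a = \<zero>") (auto simp: Zx_power_zero_base nonzero_Units)

lemma Zx_power_add_Units:
  assumes a: "a \<in> Units K"
  shows "Zx_power K a (g + h) = Zx_power K a g \<otimes> Zx_power K a h"
proof -
  have cl: "(sig K ^^ i) a [^] (z::int) \<in> carrier K" for i z
    using int_pow_Units sig_funpow_Units a by blast
  define N where "N = max (Polynomial.degree g) (Polynomial.degree h)"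
  have *: "Polynomial.degree g \<le> N" "Polynomial.degree h \<le> N" "Polynomial.degree (g + h) \<le> N"
    by (auto simp: N_def degree_add_le_max)
  show ?thesis
    unfolding Zx_power_eq_finprod[OF a *(1)] Zx_power_eq_finprod[OF a *(2)]
      Zx_power_eq_finprod[OF a *(3)]
    using cl by (simp add: int_pow_add sig_funpow_Units a flip: finprod_multf)
qed

lemma Zx_power_x:
  assumes a: "a \<in> carrier K"
  shows "Zx_power K a ([:0, 1:] * g) = sig K (Zx_power K a g)"
proof (cases "a = \<zero>")
  case True
  then show ?thesis by (simp add: Zx_power_zero_base)
next
  case False
  then have u: "a \<in> Units K"
    using a by (simp add: nonzero_Units)
  have cl: "(sig K ^^ i) a [^] (z::int) \<in> carrier K" for i z
    using int_pow_Units sig_funpow_Units u by blast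
  have Suc: "(sig K ^^ Suc i) a [^] (z::int) \<in> carrier K" for i z
    using int_pow_Units sig_funpow_Units[of a "Suc i"] u by blast
  define N where "N = Polynomial.degree g"
  have eq: "[:0, 1:] * g = pCons 0 g" by simp
  have "Polynomial.degree (pCons 0 g) \<le> Suc N"
    by (simp add: N_def)
  then have "Zx_power K a (pCons 0 g) =
      finprod K (\<lambda>i. (sig K ^^ i) a [^] Polynomial.coeff (pCons 0 g) i) {..Suc N}"
    by (rule Zx_power_eq_finprod[OF u])
  \<comment> \<open>Multiplication by x shifts the coefficients by one; the factor at index 0 has
    exponent 0 and drops out.\<close>
  also have "\<dots> = finprod K (\<lambda>i. (sig K ^^ Suc i) a [^] Polynomial.coeff g i) {..N}"
    using cl Suc by (subst finprod_Suc2) (simp_all add: Pi_def del: funpow.simps)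
  also have "\<dots> = sig K (finprod K (\<lambda>i. (sig K ^^ i) a [^] Polynomial.coeff g i) {..N})"
    using cl by (subst sig.hom_finprod) (simp_all add: Pi_def o_def sig_int_pow sig_funpow_Units u)
  finally show ?thesis
    unfolding eq by (simp add: Zx_power_eq_finprod[OF u, of g N] N_def)
qed

lemma Zx_power_1:
  assumes a: "a \<in> carrier K"
  shows "Zx_power K a 1 = a"
proof (cases "a = \<zero>")
  case False
  then show ?thesis
    using a group.int_pow_1[OF units_group, of a]
    by (simp add: nonzero_Units units_of_carrier Zx_power_eq_finprod[where N = 0] int_pow_units_of)
qed (simp add: Zx_power_zero_base)

text \<open>Z[x] is generated from 1 by addition, subtraction and multiplication by x, so two such
  maps that agree at 1 agree everywhere. This identifies a power without expanding a product over
  coefficients.\<close>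

lemma Zx_power_unique:
  assumes F: "\<And>g. F g \<in> Units K" "\<And>g h. F (g + h) = F g \<otimes> F h" "\<And>g. F ([:0, 1:] * g) = sig K (F g)"
  shows "F g = Zx_power K (F 1) g"
proof -
  define G where "G = Zx_power K (F 1)"
  have G: "\<And>g. G g \<in> Units K" "\<And>g h. G (g + h) = G g \<otimes> G h" "\<And>g. G ([:0, 1:] * g) = sig K (G g)"
    unfolding G_def using F(1)[of 1] Zx_power_x[OF Units_closed[OF F(1)[of 1]]]
    by (auto simp: Zx_power_Units Zx_power_add_Units)
  have one: "F 1 = G 1"
    using Zx_power_1[OF Units_closed[OF F(1)[of 1]]] by (simp add: G_def)
  \<comment> \<open>\<open>f 0\<close> is an idempotent unit.\<close>
  have zero: "f 0 = \<one>" if "\<And>g. f g \<in> Units K" "\<And>g h. f (g + h) = f g \<otimes> f h" for f :: "int poly \<Rightarrow> _"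
    using that(1)[of 0] that(2)[of 0 0] Units_l_cancel[of "f 0" "f 0" \<one>] by (simp add: Units_closed)
  \<comment> \<open>Values are units, so the factor at h can be cancelled; the descending half of
    the induction over the integers needs this.\<close>
  have minus: "F (g - h) = G (g - h)" if "F g = G g" "F h = G h" for g h
  proof -
    have "F h \<otimes> F (g - h) = F h \<otimes> G (g - h)"
      using that F(2)[of h "g - h"] G(2)[of h "g - h"] by simp
    then show ?thesis
      by (metis F(1) G(1) Units_closed Units_l_cancel)
  qed
  have c: "F [:z:] = G [:z:]" for z :: int
  proof (induction z rule: int_induct[where k = 0])
    case base
    show ?case using zero[OF F(1,2)] zero[OF G(1,2)] by simp
  next
    case (step1 i)
    have "[:i + 1:] = [:i:] + 1" by (simp add: one_pCons)
    then show ?case using step1 one F(2) G(2) by metis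
  next
    case (step2 i)
    have "[:i - 1:] = [:i:] - 1" by (simp add: one_pCons)
    then show ?case using step2 one minus by metis
  qed
  have "F g = G g"
  proof (induction g)
    case 0
    show ?case using zero[OF F(1,2)] zero[OF G(1,2)] by simp
  next
    case (pCons z g)
    have "pCons z g = [:z:] + [:0, 1:] * g" by simp
    then show ?case using pCons c F(2,3) G(2,3) by metis
  qed
  then show ?thesis by (simp add: G_def)
qed

end

section \<open>The semiring P[x]\<close>

lemma Px_0 [simp]: "0 \<in> Px"
  by (simp add: Px_def)

lemma x_Px: "[:0, 1:] \<in> Px"
  by (simp add: Px_def)

text \<open>Positive leading terms cannot cancel, whichever degree dominates. Hence a sum in P[x]
  vanishes only if both summands do.\<close>

lemma Px_add_pos:
  assumes "f \<in> Px" "g \<in> Px" "f \<noteq> 0"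
  shows "lead_coeff (f + g) > 0"
proof (cases "g = 0")
  case False
  then have *: "lead_coeff f > 0" "lead_coeff g > 0"
    using assms by (auto simp: Px_def)
  consider "degree f < degree g" | "degree f > degree g" | "degree f = degree g" by linarith
  then show ?thesis
  proof cases
    case 3
    then have "coeff (f + g) (degree f) > 0" using * by simp
    moreover have "degree (f + g) \<le> degree f" using 3 by (simp add: degree_add_le)
    ultimately show ?thesis
      by (metis le_antisym le_degree less_irrefl)
  qed (use * in \<open>simp_all add: degree_add_eq_left degree_add_eq_right coeff_eq_0\<close>)
qed (use assms in \<open>auto simp: Px_def\<close>)

lemma Px_add: "f \<in> Px \<Longrightarrow> g \<in> Px \<Longrightarrow> f + g \<in> Px"
  using Px_add_pos[of f g] by (cases "f = 0") (auto simp: Px_def)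

lemma Px_add_eq_0_iff: "f \<in> Px \<Longrightarrow> g \<in> Px \<Longrightarrow> f + g = 0 \<longleftrightarrow> f = 0 \<and> g = 0"
  by (metis Px_add_pos add.commute add.right_neutral leading_coeff_0_iff less_irrefl)

lemma Px_mult: "f \<in> Px \<Longrightarrow> g \<in> Px \<Longrightarrow> f * g \<in> Px"
  by (auto simp: Px_def lead_coeff_mult)

lemma Px_sum: "(\<And>i. i \<in> A \<Longrightarrow> f i \<in> Px) \<Longrightarrow> sum f A \<in> Px"
  by (induction A rule: infinite_finite_induct) (auto intro: Px_add)

section \<open>Finitely supported functions as sums of terms\<close>

lemma poly_mapping_sum_single: "(\<Sum>u\<in>Poly_Mapping.keys f. Poly_Mapping.single u (Poly_Mapping.lookup f u)) = f"
proof (rule poly_mapping_eqI)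
  fix k
  have "(\<Sum>u\<in>Poly_Mapping.keys f. Poly_Mapping.lookup f u when u = k) = Poly_Mapping.lookup f k"
  proof (cases "k \<in> Poly_Mapping.keys f")
    case True
    then have "(\<Sum>u\<in>Poly_Mapping.keys f. Poly_Mapping.lookup f u when u = k) =
        (\<Sum>u\<in>{k}. Poly_Mapping.lookup f u when u = k)"
      by (intro sum.mono_neutral_right) auto
    then show ?thesis by simp
  next
    case False
    then show ?thesis
      by (auto simp: in_keys_iff when_def intro!: sum.neutral)
  qed
  then show "Poly_Mapping.lookup (\<Sum>u\<in>Poly_Mapping.keys f. Poly_Mapping.single u (Poly_Mapping.lookup f u)) k =
      Poly_Mapping.lookup f k"
    by (simp add: lookup_sum lookup_single)
qed

text \<open>Induction over terms with exponents in A. The algebras k[S] are carved out of one type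
  by a support condition, so the hypotheses have to carry that condition along.\<close>

lemma keys_subset_induct [consumes 1, case_names zero single add]:
  fixes f :: "'a \<Rightarrow>\<^sub>0 'k::comm_monoid_add"
  assumes f: "Poly_Mapping.keys f \<subseteq> A"
    and zero: "P 0"
    and single: "\<And>u c. u \<in> A \<Longrightarrow> P (Poly_Mapping.single u c)"
    and add: "\<And>f g. Poly_Mapping.keys f \<subseteq> A \<Longrightarrow> Poly_Mapping.keys g \<subseteq> A \<Longrightarrow> P f \<Longrightarrow> P g \<Longrightarrow> P (f + g)"
  shows "P f"
proof -
  have "Poly_Mapping.keys (\<Sum>u\<in>B. Poly_Mapping.single u (Poly_Mapping.lookup f u)) \<subseteq> A \<and>
      P (\<Sum>u\<in>B. Poly_Mapping.single u (Poly_Mapping.lookup f u))"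
    if "finite B" "B \<subseteq> A" for B
    using that
  proof (induction B rule: finite_induct)
    case (insert x B)
    define g where "g = (\<Sum>u\<in>B. Poly_Mapping.single u (Poly_Mapping.lookup f u))"
    have 1: "Poly_Mapping.keys (Poly_Mapping.single x (Poly_Mapping.lookup f x)) \<subseteq> A"
      using insert by auto
    moreover have 2: "Poly_Mapping.keys g \<subseteq> A" "P g"
      using insert by (auto simp: g_def)
    ultimately have "Poly_Mapping.keys (Poly_Mapping.single x (Poly_Mapping.lookup f x) + g) \<subseteq> A"
      using keys_add by (metis (no_types, lifting) Un_subset_iff subset_trans)
    then show ?case
      using insert add[OF 1 2(1) single 2(2)] by (simp flip: g_def)
  qed (simp add: zero)
  from this[OF finite_keys f] show ?thesis
    by (simp add: poly_mapping_sum_single)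
qed

lemma keys_add_subset:
  "Poly_Mapping.keys f \<subseteq> A \<Longrightarrow> Poly_Mapping.keys g \<subseteq> A \<Longrightarrow> Poly_Mapping.keys (f + g) \<subseteq> A"
  using keys_add[of f g] by blast

lemma keys_mult_subset:
  assumes "Poly_Mapping.keys f \<subseteq> A" "Poly_Mapping.keys g \<subseteq> A" "\<And>u v. u \<in> A \<Longrightarrow> v \<in> A \<Longrightarrow> u + v \<in> A"
  shows "Poly_Mapping.keys (f * g) \<subseteq> A"
  using assms keys_mult[of f g] by fastforce

section \<open>Monomial maps between monoid algebras\<close>

text \<open>The additive extension of a map on terms. The coefficient map may depend on the
  exponent, so that one construction covers \<sigma> on a monoid algebra, the substitution of Y^u by
  d^u \<chi>^(E u), and the relabelling of exponents by a lattice embedding.\<close>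

definition push ::
  "('a \<Rightarrow> 'b) \<Rightarrow> ('a \<Rightarrow> 'k::zero \<Rightarrow> 'l::comm_monoid_add) \<Rightarrow> ('a \<Rightarrow>\<^sub>0 'k) \<Rightarrow> ('b \<Rightarrow>\<^sub>0 'l)" where
  "push E \<tau> f =
     (\<Sum>u\<in>Poly_Mapping.keys f. Poly_Mapping.single (E u) (\<tau> u (Poly_Mapping.lookup f u)))"

text \<open>Comparing several functions needs a common index set; exponents outside the support add
  nothing, as \<open>\<tau> u 0 = 0\<close>.\<close>

lemma push_superset:
  assumes "finite A" "Poly_Mapping.keys f \<subseteq> A" "\<And>u. \<tau> u 0 = 0"
  shows "push E \<tau> f = (\<Sum>u\<in>A. Poly_Mapping.single (E u) (\<tau> u (Poly_Mapping.lookup f u)))"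
  unfolding push_def using assms by (intro sum.mono_neutral_left) (auto simp: in_keys_iff)

lemma push_zero [simp]: "push E \<tau> 0 = 0"
  by (simp add: push_def)

lemma push_single: "(\<And>u. \<tau> u 0 = 0) \<Longrightarrow> push E \<tau> (Poly_Mapping.single u c) = Poly_Mapping.single (E u) (\<tau> u c)"
  by (subst push_superset[where A = "{u}"]) auto

lemma push_add:
  fixes f g :: "'a \<Rightarrow>\<^sub>0 'k::comm_monoid_add"
  assumes "\<And>u. \<tau> u 0 = 0" "\<And>u c d. \<tau> u (c + d) = \<tau> u c + \<tau> u d"
  shows "push E \<tau> (f + g) = push E \<tau> f + push E \<tau> g"
proof -
  define A where "A = Poly_Mapping.keys f \<union> Poly_Mapping.keys g"
  have A: "finite A" "Poly_Mapping.keys f \<subseteq> A" "Poly_Mapping.keys g \<subseteq> A" "Poly_Mapping.keys (f + g) \<subseteq> A"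
    using keys_add[of f g] by (auto simp: A_def)
  show ?thesis
    using assms A by (simp add: push_superset[OF A(1)] lookup_add single_add sum.distrib)
qed

text \<open>Membership in B is asked only where the new coefficient can be nonzero, so an exponent
  whose coefficient d^u is 0 need not land in S.\<close>

lemma keys_push:
  assumes "Poly_Mapping.keys f \<subseteq> A" "\<And>u c. u \<in> A \<Longrightarrow> \<tau> u c \<noteq> 0 \<Longrightarrow> E u \<in> B"
  shows "Poly_Mapping.keys (push E \<tau> f) \<subseteq> B"
proof -
  have "Poly_Mapping.keys (push E \<tau> f) \<subseteq>
     (\<Union>u\<in>Poly_Mapping.keys f. Poly_Mapping.keys (Poly_Mapping.single (E u) (\<tau> u (Poly_Mapping.lookup f u))))"
    unfolding push_def by (rule keys_sum)
  also have "\<dots> \<subseteq> B"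
    using assms by (auto split: if_splits)
  finally show ?thesis .
qed

text \<open>Both sides are additive in f and in g, so terms suffice. The laws are asked on A only,
  because d^(u+v) = d^u d^v may fail outside P[x]^m when some d_i is 0.\<close>

lemma push_mult:
  fixes f g :: "'a::comm_monoid_add \<Rightarrow>\<^sub>0 'k::comm_ring_1" and \<tau> :: "'a \<Rightarrow> 'k \<Rightarrow> 'l::comm_ring_1"
    and E :: "'a \<Rightarrow> 'b::comm_monoid_add"
  assumes \<tau>: "\<And>u. \<tau> u 0 = 0" "\<And>u c d. \<tau> u (c + d) = \<tau> u c + \<tau> u d"
    and f: "Poly_Mapping.keys f \<subseteq> A" and g: "Poly_Mapping.keys g \<subseteq> A"
    and E: "\<And>u v. u \<in> A \<Longrightarrow> v \<in> A \<Longrightarrow> E (u + v) = E u + E v"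
    and mult: "\<And>u v c d. u \<in> A \<Longrightarrow> v \<in> A \<Longrightarrow> \<tau> (u + v) (c * d) = \<tau> u c * \<tau> v d"
  shows "push E \<tau> (f * g) = push E \<tau> f * push E \<tau> g"
  using f
proof (induction f rule: keys_subset_induct)
  case (single u c)
  note u = this
  show ?case using g
  proof (induction g rule: keys_subset_induct)
    case (single v d)
    then show ?case
      using u by (simp add: push_single[of \<tau>, OF \<tau>(1)] mult_single E mult)
  qed (simp_all add: distrib_left push_add[of \<tau>, OF \<tau>])
qed (simp_all add: distrib_right push_add[of \<tau>, OF \<tau>])

section \<open>Monoid algebras as commutative rings, and exponents in P[x]^m\<close>

lemma monoid_algebra_simps:
  "carrier (monoid_algebra \<sigma> scale S) = {f. Poly_Mapping.keys f \<subseteq> S}"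
  "f \<otimes>\<^bsub>monoid_algebra \<sigma> scale S\<^esub> g = f * g"
  "f \<oplus>\<^bsub>monoid_algebra \<sigma> scale S\<^esub> g = f + g"
  "\<one>\<^bsub>monoid_algebra \<sigma> scale S\<^esub> = 1"
  "\<zero>\<^bsub>monoid_algebra \<sigma> scale S\<^esub> = 0"
  "smap (monoid_algebra \<sigma> scale S) c = Poly_Mapping.single 0 c"
  "sig (monoid_algebra \<sigma> scale S) = push (scale [:0, 1:]) (\<lambda>_. \<sigma>)"
  "terms (monoid_algebra \<sigma> scale S) = {Poly_Mapping.single u c | u c. u \<in> S}"
  by (simp_all add: monoid_algebra_def push_def fun_eq_iff)

lemma cring_monoid_algebra:
  fixes S :: "'m::comm_monoid_add set"
  assumes "0 \<in> S" "\<And>u v. u \<in> S \<Longrightarrow> v \<in> S \<Longrightarrow> u + v \<in> S"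
  shows "cring (monoid_algebra \<sigma> scale S)"
proof (rule cringI)
  show "abelian_group (monoid_algebra \<sigma> scale S)"
  proof (rule abelian_groupI; (simp add: monoid_algebra_simps keys_add_subset ac_simps)?)
    fix f :: "'m \<Rightarrow>\<^sub>0 'a" assume "Poly_Mapping.keys f \<subseteq> S"
    then show "\<exists>g. Poly_Mapping.keys g \<subseteq> S \<and> f + g = 0"
      by (intro exI[of _ "-f"]) (auto simp: in_keys_iff)
  qed
  show "comm_monoid (monoid_algebra \<sigma> scale S)"
    by (intro comm_monoidI) (simp_all add: monoid_algebra_simps ac_simps keys_mult_subset assms)
qed (auto simp: monoid_algebra_simps distrib_right)

lemma Px_pow_0 [simp]: "0 \<in> Px_pow m"
  and Px_pow_add: "u \<in> Px_pow m \<Longrightarrow> v \<in> Px_pow m \<Longrightarrow> u + v \<in> Px_pow m"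
  and Px_pow_scale: "g \<in> Px \<Longrightarrow> u \<in> Px_pow m \<Longrightarrow> Zx_scale g u \<in> Px_pow m"
  using keys_add_subset[of u "{..<m}" v]
  by (auto simp: Px_pow_def Zx_pow_def lookup_add Px_add lookup_Zx_scale Px_mult in_keys_iff subset_iff)

lemma Px_pow_Zx_pow: "u \<in> Px_pow m \<Longrightarrow> u \<in> Zx_pow m"
  by (simp add: Px_pow_def)

lemma Zx_scale_scale: "Zx_scale g (Zx_scale h u) = Zx_scale (g * h) u"
  and Zx_scale_add_left: "Zx_scale (g + h) u = Zx_scale g u + Zx_scale h u"
  and Zx_scale_0_left [simp]: "Zx_scale 0 u = 0"
  and Zx_scale_sum: "Zx_scale g (sum w A) = (\<Sum>i\<in>A. Zx_scale g (w i))"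
  by (auto intro!: poly_mapping_eqI simp: lookup_Zx_scale lookup_add algebra_simps lookup_sum sum_distrib_left)

lemma cring_psigma_poly: "cring (psigma_poly \<sigma> m)"
  unfolding psigma_poly_def by (rule cring_monoid_algebra) (auto intro: Px_pow_add)

lemmas psigma_poly_simps = monoid_algebra_simps[where scale = Zx_scale and S = "Px_pow m" for m, folded psigma_poly_def]

lemma sigma_field_simps:
  assumes "sigma_field \<sigma>"
  shows "\<sigma> (c + d) = \<sigma> c + \<sigma> d" "\<sigma> (c * d) = \<sigma> c * \<sigma> d" "\<sigma> 0 = 0" "\<sigma> 1 = 1"
proof -
  show 1: "\<sigma> (c + d) = \<sigma> c + \<sigma> d" and "\<sigma> (c * d) = \<sigma> c * \<sigma> d" and "\<sigma> 1 = 1" for c d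
    using assms by (auto simp: sigma_field_def ring_hom_def ring_of_type_algebra_def)
  show "\<sigma> 0 = 0"
    using 1[of 0 0] by simp
qed

lemma psigma_poly_sig:
  assumes \<sigma>: "sigma_field \<sigma>"
  shows "Poly_Mapping.keys f \<subseteq> Px_pow m \<Longrightarrow> Poly_Mapping.keys (sig (psigma_poly \<sigma> m) f) \<subseteq> Px_pow m"
    "sig (psigma_poly \<sigma> m) (f + g) = sig (psigma_poly \<sigma> m) f + sig (psigma_poly \<sigma> m) g"
    "sig (psigma_poly \<sigma> m) (Poly_Mapping.single u c) = Poly_Mapping.single (Zx_scale [:0, 1:] u) (\<sigma> c)"
    "sig (psigma_poly \<sigma> m) 0 = 0"
  unfolding psigma_poly_simps using sigma_field_simps[OF \<sigma>]
  by (simp_all add: push_single push_add keys_push[where A = "Px_pow m"] Px_pow_scale x_Px)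

section \<open>Evaluation\<close>

context sigma_ext
begin

lemma Zx_power_eq_zero_iff: "a \<in> carrier K \<Longrightarrow> Zx_power K a g = \<zero> \<longleftrightarrow> a = \<zero> \<and> g \<noteq> 0"
  using Zx_power_Units[of a g] by (auto simp: nonzero_Units Zx_power_zero_base)

text \<open>For a = 0 this is the absence of cancellation in P[x]; with exponents 1 and -1 it would
  be false.\<close>

lemma Zx_power_add:
  assumes "a \<in> carrier K" "g \<in> Px" "h \<in> Px"
  shows "Zx_power K a (g + h) = Zx_power K a g \<otimes> Zx_power K a h"
  using assms Zx_power_add_Units[of a g h]
  by (cases "a = \<zero>") (auto simp: nonzero_Units Zx_power_zero_base Px_add_eq_0_iff)

lemma eval_mono_0: "eval_mono K a 0 = \<one>"
  by (simp add: eval_mono_def)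

context
  fixes a :: "nat \<Rightarrow> 'u" and m :: nat assumes a: "a \<in> {..<m} \<rightarrow> carrier K"
begin

lemma point_closed [simp]: "i < m \<Longrightarrow> a i \<in> carrier K"
  using a by auto

lemma eval_mono_eq:
  assumes "u \<in> Zx_pow m"
  shows "eval_mono K a u = finprod K (\<lambda>i. Zx_power K (a i) (Poly_Mapping.lookup u i)) {..<m}"
  unfolding eval_mono_def
  using assms a by (intro finprod_mono_neutral_cong_left) (auto simp: Zx_pow_def in_keys_iff Pi_def)

lemma eval_mono_closed: "u \<in> Zx_pow m \<Longrightarrow> eval_mono K a u \<in> carrier K"
  using a by (auto simp: eval_mono_eq)

lemma eval_mono_add:
  assumes "u \<in> Px_pow m" "v \<in> Px_pow m"
  shows "eval_mono K a (u + v) = eval_mono K a u \<otimes> eval_mono K a v"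
proof -
  have "eval_mono K a (u + v) = finprod K (\<lambda>i. Zx_power K (a i) (Poly_Mapping.lookup u i + Poly_Mapping.lookup v i)) {..<m}"
    using assms by (simp add: eval_mono_eq Px_pow_Zx_pow Px_pow_add lookup_add)
  also have "\<dots> = finprod K (\<lambda>i. Zx_power K (a i) (Poly_Mapping.lookup u i) \<otimes> Zx_power K (a i) (Poly_Mapping.lookup v i)) {..<m}"
    using a assms by (intro finprod_cong') (auto simp: Px_pow_def intro!: Zx_power_add)
  also have "\<dots> = eval_mono K a u \<otimes> eval_mono K a v"
    using a assms by (subst finprod_multf) (auto simp: eval_mono_eq Px_pow_Zx_pow)
  finally show ?thesis .
qed

lemma eval_mono_x:
  assumes "u \<in> Px_pow m"
  shows "eval_mono K a (Zx_scale [:0, 1:] u) = sig K (eval_mono K a u)"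
proof -
  have "sig K (eval_mono K a u) = finprod K (sig K \<circ> (\<lambda>i. Zx_power K (a i) (Poly_Mapping.lookup u i))) {..<m}"
    using assms a by (subst sig.hom_finprod[symmetric]) (auto simp: eval_mono_eq Px_pow_Zx_pow)
  also have "\<dots> = eval_mono K a (Zx_scale [:0, 1:] u)"
    using a assms by (subst eval_mono_eq)
      (auto simp: Px_pow_Zx_pow Px_pow_scale x_Px lookup_Zx_scale simp del: mult_pCons_left
         intro!: finprod_cong' Zx_power_x[symmetric])
  finally show ?thesis by simp
qed

text \<open>A product in a field vanishes only through a factor. Over K this yields the
  P[\<sigma>]-ideal property at a point; over k it decides which monomials survive when some d_i are
  0.\<close>

lemma eval_mono_eq_zero_iff:
  "u \<in> Zx_pow m \<Longrightarrow> eval_mono K a u = \<zero> \<longleftrightarrow> (\<exists>i<m. a i = \<zero> \<and> Poly_Mapping.lookup u i \<noteq> 0)"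
  using a by (simp add: eval_mono_eq finprod_eq_zero_iff Pi_def) (auto simp: Zx_power_eq_zero_iff)

lemma eval_closed: "Poly_Mapping.keys f \<subseteq> Px_pow m \<Longrightarrow> eval_psigma K a f \<in> carrier K"
  unfolding eval_psigma_def by (auto intro!: finsum_closed eval_mono_closed Px_pow_Zx_pow)

lemma eval_superset:
  assumes "finite A" "Poly_Mapping.keys f \<subseteq> A" "A \<subseteq> Px_pow m"
  shows "eval_psigma K a f = finsum K (\<lambda>u. smap K (Poly_Mapping.lookup f u) \<otimes> eval_mono K a u) A"
  unfolding eval_psigma_def using assms
  by (intro add.finprod_mono_neutral_cong_left) (auto simp: in_keys_iff eval_mono_closed Px_pow_Zx_pow subset_iff)

lemma eval_zero [simp]: "eval_psigma K a 0 = \<zero>"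
  by (simp add: eval_psigma_def)

lemma eval_single:
  "u \<in> Px_pow m \<Longrightarrow> eval_psigma K a (Poly_Mapping.single u c) = smap K c \<otimes> eval_mono K a u"
  by (subst eval_superset[where A = "{u}"]) (auto simp: eval_mono_closed Px_pow_Zx_pow)

lemma eval_add:
  assumes "Poly_Mapping.keys f \<subseteq> Px_pow m" "Poly_Mapping.keys g \<subseteq> Px_pow m"
  shows "eval_psigma K a (f + g) = eval_psigma K a f \<oplus> eval_psigma K a g"
proof -
  define A where "A = Poly_Mapping.keys f \<union> Poly_Mapping.keys g"
  have A: "finite A" "Poly_Mapping.keys f \<subseteq> A" "Poly_Mapping.keys g \<subseteq> A"
    "Poly_Mapping.keys (f + g) \<subseteq> A" "A \<subseteq> Px_pow m"
    using keys_add[of f g] assms by (auto simp: A_def)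
  have "eval_psigma K a (f + g) = finsum K (\<lambda>u. smap K (Poly_Mapping.lookup f u) \<otimes> eval_mono K a u \<oplus>
      smap K (Poly_Mapping.lookup g u) \<otimes> eval_mono K a u) A"
    unfolding eval_superset[OF A(1,4,5)] using A(5)
    by (intro finsum_cong') (auto simp: lookup_add smap_add eval_mono_closed Px_pow_Zx_pow subset_iff l_distr)
  also have "\<dots> = eval_psigma K a f \<oplus> eval_psigma K a g"
    using A by (subst finsum_addf)
      (auto simp: eval_mono_closed Px_pow_Zx_pow subset_iff eval_superset[of A])
  finally show ?thesis .
qed

lemma eval_mult:
  assumes f: "Poly_Mapping.keys f \<subseteq> Px_pow m" and g: "Poly_Mapping.keys g \<subseteq> Px_pow m"
  shows "eval_psigma K a (f * g) = eval_psigma K a f \<otimes> eval_psigma K a g"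
  using f
proof (induction f rule: keys_subset_induct)
  case (single u c)
  note u = this
  show ?case using g
  proof (induction g rule: keys_subset_induct)
    case (single v d)
    then show ?case
      using u by (simp add: mult_single eval_single Px_pow_add eval_mono_add smap_mult eval_mono_closed
          Px_pow_Zx_pow m_ac)
  next
    case (add f g)
    then show ?case
      using u by (simp add: distrib_left eval_add keys_mult_subset Px_pow_add eval_closed r_distr)
  qed (use u in \<open>simp add: eval_closed\<close>)
next
  case (add f f')
  then show ?case
    using g by (simp add: distrib_right eval_add keys_mult_subset Px_pow_add eval_closed l_distr)
qed (use g in \<open>simp add: eval_closed\<close>)

lemma eval_one: "eval_psigma K a 1 = \<one>"
  using eval_single[of 0 1] by (simp add: eval_mono_0)

lemma eval_hom: "ring_hom_cring (psigma_poly \<sigma>' m) K (eval_psigma K a)"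
  using cring_psigma_poly is_cring
  by (auto simp: ring_hom_cring_def ring_hom_cring_axioms_def ring_hom_def psigma_poly_simps
      eval_closed eval_add eval_mult eval_one)

lemma eval_sig:
  assumes \<sigma>: "sigma_field \<sigma>" and f: "Poly_Mapping.keys f \<subseteq> Px_pow m"
  shows "eval_psigma K a (sig (psigma_poly \<sigma> m) f) = sig K (eval_psigma K a f)"
  using f
proof (induction f rule: keys_subset_induct)
  case (single u c)
  then show ?case
    by (simp add: psigma_poly_sig[OF \<sigma>] eval_single Px_pow_scale x_Px eval_mono_x sig_smap
        eval_mono_closed Px_pow_Zx_pow)
next
  case (add f g)
  then show ?case
    by (simp add: psigma_poly_sig[OF \<sigma>] eval_add eval_closed)
qed (simp add: psigma_poly_sig[OF \<sigma>])

end

end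

section \<open>Coordinate rings and prime ideals\<close>

lemma psigma_quotient_simps:
  "carrier (psigma_quotient R I) = carrier (R Quot I)"
  "monoid.mult (psigma_quotient R I) = monoid.mult (R Quot I)"
  "ring.add (psigma_quotient R I) = ring.add (R Quot I)"
  "\<one>\<^bsub>psigma_quotient R I\<^esub> = \<one>\<^bsub>R Quot I\<^esub>"
  "\<zero>\<^bsub>psigma_quotient R I\<^esub> = \<zero>\<^bsub>R Quot I\<^esub>"
  "smap (psigma_quotient R I) c = I +>\<^bsub>R\<^esub> smap R c"
  "sig (psigma_quotient R I) C = (\<Union>f\<in>C. I +>\<^bsub>R\<^esub> sig R f)"
  "terms (psigma_quotient R I) = {I +>\<^bsub>R\<^esub> t | t. t \<in> terms R}"
  by (simp_all add: psigma_quotient_def)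

lemma carrier_Quot: "carrier (R Quot I) = {I +>\<^bsub>R\<^esub> f | f. f \<in> carrier R}"
  by (auto simp: FactRing_def A_RCOSETS_def')

text \<open>First isomorphism theorem with the extra structure. Terms are mapped onto terms, not
  merely into them, and therefore the inverse preserves terms as well.\<close>

lemma psigma_iso_quotient:
  fixes R :: "('a, 'k) psigma_algebra" and B :: "('b, 'k) psigma_algebra"
  assumes \<Phi>: "ring_hom_ring R B \<Phi>" and surj: "\<Phi> ` carrier R = carrier B"
    and sig: "\<And>f. f \<in> carrier R \<Longrightarrow> sig R f \<in> carrier R" "\<And>f. f \<in> carrier R \<Longrightarrow> \<Phi> (sig R f) = sig B (\<Phi> f)"
    and smap: "\<And>c. smap R c \<in> carrier R" "\<And>c. \<Phi> (smap R c) = smap B c"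
    and terms: "terms R \<subseteq> carrier R" "\<Phi> ` terms R = terms B"
  shows "psigma_iso (psigma_quotient R (a_kernel R B \<Phi>)) B (\<lambda>C. the_elem (\<Phi> ` C))"
proof -
  interpret ring_hom_ring R B \<Phi> by fact
  define I where "I = a_kernel R B \<Phi>"
  define Q where "Q = psigma_quotient R I"
  define h where "h = (\<lambda>C. the_elem (\<Phi> ` C))"
  interpret I: ideal I R
    unfolding I_def by (rule kernel_is_ideal)
  have Q_Quot: "carrier Q = carrier (R Quot I)"
    by (simp add: Q_def psigma_quotient_simps)
  have carrierQ: "carrier Q = {I +>\<^bsub>R\<^esub> f | f. f \<in> carrier R}"
    by (simp add: Q_def psigma_quotient_simps carrier_Quot)
  have h_cls: "h (I +>\<^bsub>R\<^esub> f) = \<Phi> f" if "f \<in> carrier R" for f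
    unfolding h_def I_def using that by (rule the_elem_simp)
  have iso: "h \<in> ring_iso (R Quot I) B"
    unfolding h_def I_def by (rule FactRing_iso_set[OF surj])
  then have bij: "bij_betw h (carrier Q) (carrier B)"
    by (simp add: ring_iso_def Q_Quot)
  have "inv_into (carrier Q) h \<in> ring_iso B (R Quot I)"
    unfolding Q_Quot by (rule ring_iso_set_sym[OF I.quotient_is_ring iso])
  then have inv_hom: "inv_into (carrier Q) h \<in> ring_hom B Q"
    by (simp add: ring_iso_def ring_hom_def Q_def psigma_quotient_simps)
  have hom: "h \<in> ring_hom Q B"
    using iso by (simp add: ring_iso_def ring_hom_def Q_def psigma_quotient_simps)
  \<comment> \<open>On a coset \<sigma> is a union over its members. The union collapses because h
    is injective and all the cosets involved have the same image under h.\<close>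
  have sig_cls: "sig Q (I +>\<^bsub>R\<^esub> f) = I +>\<^bsub>R\<^esub> sig R f" if f: "f \<in> carrier R" for f
  proof -
    have *: "I +>\<^bsub>R\<^esub> sig R g = I +>\<^bsub>R\<^esub> sig R f" if g: "g \<in> I +>\<^bsub>R\<^esub> f" for g
    proof -
      have gR: "g \<in> carrier R"
        using g f R.a_r_coset_subset_G[OF I.a_subset f] by blast
      have "\<Phi> g = \<Phi> f"
        using rcos_imp_homeq[OF f] g by (simp add: I_def)
      then have "h (I +>\<^bsub>R\<^esub> sig R g) = h (I +>\<^bsub>R\<^esub> sig R f)"
        using f gR by (simp add: h_cls sig)
      moreover have "I +>\<^bsub>R\<^esub> sig R g \<in> carrier Q" "I +>\<^bsub>R\<^esub> sig R f \<in> carrier Q"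
        using f gR sig(1) by (auto simp: carrierQ)
      ultimately show ?thesis
        by (rule inj_onD[OF bij_betw_imp_inj_on[OF bij]])
    qed
    have "I +>\<^bsub>R\<^esub> f \<noteq> {}"
      using I.a_rcos_self[OF f] by blast
    then have "(\<Union>g\<in>I +>\<^bsub>R\<^esub> f. I +>\<^bsub>R\<^esub> sig R g) = I +>\<^bsub>R\<^esub> sig R f"
      by (rule SUP_eq_const) (rule *)
    then show ?thesis
      by (simp only: Q_def psigma_quotient_simps)
  qed
  have h_sig: "h (sig Q C) = sig B (h C)" "sig Q C \<in> carrier Q" if "C \<in> carrier Q" for C
    using that sig by (auto simp: carrierQ sig_cls h_cls)
  have inv_h: "inv_into (carrier Q) h (h C) = C" if "C \<in> carrier Q" for C
    using bij that by (simp add: bij_betw_def)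
  have terms_Q: "terms Q = {I +>\<^bsub>R\<^esub> t | t. t \<in> terms R}" "terms Q \<subseteq> carrier Q"
    using terms(1) unfolding carrierQ by (auto simp: Q_def psigma_quotient_simps)
  have h_terms: "h ` terms Q = terms B"
  proof -
    have "h ` terms Q = \<Phi> ` terms R"
      using terms(1) unfolding terms_Q(1)
      by (auto simp: image_iff h_cls subset_iff intro!: exI bexI)
    then show ?thesis
      using terms(2) by simp
  qed
  have smap_Q: "smap Q c \<in> carrier Q" "h (smap Q c) = smap B c" for c
    unfolding carrierQ using smap by (auto simp: Q_def psigma_quotient_simps h_cls)
  have "psigma_hom Q B h"
    using hom h_sig smap_Q h_terms by (auto simp: psigma_hom_def)
  moreover have "psigma_hom B Q (inv_into (carrier Q) h)"
  proof -
    have "inv_into (carrier Q) h (sig B b) = sig Q (inv_into (carrier Q) h b)" if "b \<in> carrier B" for b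
    proof -
      obtain C where "C \<in> carrier Q" "b = h C"
        using \<open>b \<in> carrier B\<close> bij by (auto simp: bij_betw_def)
      then show ?thesis
        by (metis h_sig inv_h)
    qed
    moreover have "inv_into (carrier Q) h (smap B c) = smap Q c" for c
      using inv_h smap_Q by metis
    moreover have "inv_into (carrier Q) h ` terms B \<subseteq> terms Q"
      using inv_h terms_Q(2) by (auto simp flip: h_terms)
    ultimately show ?thesis
      using inv_hom by (auto simp: psigma_hom_def)
  qed
  ultimately show ?thesis
    using bij by (simp add: psigma_iso_def Q_def I_def h_def)
qed

context sigma_ext
begin

text \<open>Values lie in a domain, which gives primality. The kernel is perfect because \<sigma>
  and powers preserve units, and it is a P[\<sigma>]-ideal because the vanishing of a monomial at a
  depends only on the variables occurring in it.\<close>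

lemma psigma_prime_eval_kernel:
  assumes \<sigma>: "sigma_field \<sigma>" and a: "a \<in> {..<m} \<rightarrow> carrier K"
  shows "psigma_prime \<sigma> m {f \<in> carrier (psigma_poly \<sigma> m). eval_psigma K a f = \<zero>}"
    (is "psigma_prime \<sigma> m ?P")
proof -
  interpret R: cring "psigma_poly \<sigma> m" by (rule cring_psigma_poly)
  have hom: "ring_hom_cring (psigma_poly \<sigma> m) K (eval_psigma K a)"
    using a by (rule eval_hom)
  then have hom': "ring_hom_ring (psigma_poly \<sigma> m) K (eval_psigma K a)"
    by (intro ring_hom_ringI2 R.ring_axioms is_ring) (rule ring_hom_cring.homh)
  have homh: "eval_psigma K a \<in> ring_hom (psigma_poly \<sigma> m) K"
    using hom by (rule ring_hom_cring.homh)
  have closed [simp]: "eval_psigma K a f \<in> carrier K" if "f \<in> carrier (psigma_poly \<sigma> m)" for f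
    using that by (rule ring_hom_closed[OF homh])
  have P: "?P = a_kernel (psigma_poly \<sigma> m) K (eval_psigma K a)"
    by (simp add: a_kernel_def')
  have "ideal ?P (psigma_poly \<sigma> m)"
    unfolding P by (rule ring_hom_ring.kernel_is_ideal[OF hom'])
  then have "primeideal ?P (psigma_poly \<sigma> m)"
  proof (rule primeidealI)
    show "cring (psigma_poly \<sigma> m)" by (rule cring_psigma_poly)
    show "carrier (psigma_poly \<sigma> m) \<noteq> ?P"
      using ring_hom_one[OF homh] R.one_closed zero_not_one by (metis (mono_tags, lifting) mem_Collect_eq)
  qed (auto simp: integral_iff ring_hom_mult[OF homh])
  moreover have "sig (psigma_poly \<sigma> m) ` ?P \<subseteq> ?P"
    using psigma_poly_sig(1)[OF \<sigma>] eval_sig[OF a \<sigma>] by (auto simp: psigma_poly_simps(1))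
  moreover have "f \<in> ?P"
    if f: "f \<in> carrier (psigma_poly \<sigma> m)" and g: "Nx_power (psigma_poly \<sigma> m) f g \<in> ?P" for f g
  proof -
    have sig_pow: "(sig (psigma_poly \<sigma> m) ^^ i) f \<in> carrier (psigma_poly \<sigma> m) \<and>
        eval_psigma K a ((sig (psigma_poly \<sigma> m) ^^ i) f) = (sig K ^^ i) (eval_psigma K a f)" for i
      using f psigma_poly_sig(1)[OF \<sigma>] eval_sig[OF a \<sigma>]
      by (induction i) (auto simp: psigma_poly_simps(1))
    have "finprod K (\<lambda>i. (sig K ^^ i) (eval_psigma K a f) [^] Polynomial.coeff g i) {..Polynomial.degree g} = 
        finprod K (eval_psigma K a \<circ> (\<lambda>i. (sig (psigma_poly \<sigma> m) ^^ i) f [^]\<^bsub>psigma_poly \<sigma> m\<^esub> Polynomial.coeff g i))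
          {..Polynomial.degree g}"
      using sig_pow f by (intro finprod_cong') (auto simp: ring_hom_ring.hom_nat_pow[OF hom'])
    also have "\<dots> = eval_psigma K a (Nx_power (psigma_poly \<sigma> m) f g)"
      unfolding Nx_power_def using sig_pow by (subst ring_hom_cring.hom_finprod[OF hom]) auto
    also have "\<dots> = \<zero>" using g by simp
    finally have "\<exists>i. (sig K ^^ i) (eval_psigma K a f) [^] Polynomial.coeff g i = \<zero>"
      using f by (subst (asm) finprod_eq_zero_iff) auto
    then obtain i where i: "(sig K ^^ i) (eval_psigma K a f) [^] Polynomial.coeff g i = \<zero>" ..
    have "eval_psigma K a f = \<zero>"
    proof (rule ccontr)
      assume "eval_psigma K a f \<noteq> \<zero>"
      then have "(sig K ^^ i) (eval_psigma K a f) \<in> Units K"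
        using f by (intro sig_funpow_Units) (simp add: nonzero_Units)
      then show False
        using i Units_pow_closed nonzero_Units by metis
    qed
    then show ?thesis using f by simp
  qed
  moreover have "Poly_Mapping.single (Zx_scale g u) 1 * f \<in> ?P"
    if u: "u \<in> Px_pow m" and f: "f \<in> carrier (psigma_poly \<sigma> m)"
      and 0: "Poly_Mapping.single u 1 * f \<in> ?P" and g: "g \<in> Px - {0}" for u f g
  proof -
    have keys: "Poly_Mapping.keys (Poly_Mapping.single v (1::'k)) \<subseteq> Px_pow m" "Poly_Mapping.keys f \<subseteq> Px_pow m"
      if "v \<in> Px_pow m" for v
      using that f by (auto simp: psigma_poly_simps(1))
    have gu: "Zx_scale g u \<in> Px_pow m"
      using g u by (simp add: Px_pow_scale)
    have "eval_mono K a u \<otimes> eval_psigma K a f = \<zero>"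
      using 0 u keys by (simp add: eval_mult[OF a] eval_single[OF a] eval_mono_closed[OF a] Px_pow_Zx_pow)
    then have "eval_mono K a u = \<zero> \<or> eval_psigma K a f = \<zero>"
      using f u by (simp add: integral_iff eval_mono_closed[OF a] Px_pow_Zx_pow)
    then have "eval_mono K a (Zx_scale g u) \<otimes> eval_psigma K a f = \<zero>"
    proof
      assume "eval_mono K a u = \<zero>"
      \<comment> \<open>As Z[x] has no zero divisors and g is nonzero, u and g u involve the same
        variables.\<close>
      then have "eval_mono K a (Zx_scale g u) = \<zero>"
        using u gu g by (auto simp: eval_mono_eq_zero_iff[OF a] Px_pow_Zx_pow lookup_Zx_scale)
      then show ?thesis using f by simp
    qed (use gu in \<open>simp add: eval_mono_closed[OF a] Px_pow_Zx_pow\<close>)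
    then show ?thesis
      using keys gu keys_mult_subset[of "Poly_Mapping.single (Zx_scale g u) (1::'k)" "Px_pow m" f]
      by (auto simp: psigma_poly_simps(1) eval_mult[OF a] eval_single[OF a] eval_mono_closed[OF a]
          Px_pow_Zx_pow Px_pow_add)
  qed
  ultimately show ?thesis
    unfolding psigma_prime_def by blast
qed

end

section \<open>Affine varieties: values of classes at points, spectra and their topology\<close>

locale affine_variety =
  fixes \<sigma> :: "'k::field_char_0 \<Rightarrow> 'k" and m :: nat and V :: "('u, 'k) point_functor"
  assumes \<sigma>: "sigma_field \<sigma>" and V: "affine_psigma_variety \<sigma> m V"
begin

abbreviation R where "R \<equiv> psigma_poly \<sigma> m"
abbreviation I where "I \<equiv> vanishing_ideal \<sigma> m V"

definition cls :: "((nat \<Rightarrow>\<^sub>0 int poly) \<Rightarrow>\<^sub>0 'k) \<Rightarrow> ((nat \<Rightarrow>\<^sub>0 int poly) \<Rightarrow>\<^sub>0 'k) set" where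
  "cls f = I +>\<^bsub>R\<^esub> f"

sublocale R: cring R
  by (rule cring_psigma_poly)

lemma point_ext: "a \<in> V K \<Longrightarrow> sigma_field_ext \<sigma> K"
  using V by (auto simp: affine_psigma_variety_def zero_functor_def)

lemma point_sigma_ext: "a \<in> V K \<Longrightarrow> sigma_ext K \<sigma>"
  using point_ext by (simp add: sigma_ext_def sigma_ext_axioms_def sigma_field_ext_def)

lemma point_Pi: "a \<in> V K \<Longrightarrow> a \<in> {..<m} \<rightarrow> carrier K"
  using V by (auto simp: affine_psigma_variety_def zero_functor_def)

lemma eval_point_hom: "a \<in> V K \<Longrightarrow> ring_hom_cring R K (eval_psigma K a)"
  using sigma_ext.eval_hom[OF point_sigma_ext point_Pi] by blast

text \<open>V has no points on records that are not extensions, so K may range over all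
  records.\<close>

lemma vanishing_iff: "f \<in> I \<longleftrightarrow> f \<in> carrier R \<and> (\<forall>K. \<forall>a\<in>V K. eval_psigma K a f = \<zero>\<^bsub>K\<^esub>)"
  using point_ext by (auto simp: vanishing_ideal_def)

sublocale I: ideal I R
proof (rule idealI)
  show "ring R" by (rule R.ring_axioms)
  show "subgroup I (add_monoid R)"
  proof (rule R.add.subgroupI)
    have "\<zero>\<^bsub>R\<^esub> \<in> I"
      using ring_hom_cring.hom_zero[OF eval_point_hom] by (auto simp: vanishing_iff)
    then show "I \<noteq> {}" by blast
    show "\<ominus>\<^bsub>R\<^esub> f \<in> I" if "f \<in> I" for f
    proof -
      have "eval_psigma K a (\<ominus>\<^bsub>R\<^esub> f) = \<zero>\<^bsub>K\<^esub>" if a: "a \<in> V K" for K a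
      proof -
        interpret ring_hom_cring R K "eval_psigma K a" using a by (rule eval_point_hom)
        show ?thesis using \<open>f \<in> I\<close> a by (auto simp: vanishing_iff)
      qed
      then show ?thesis using \<open>f \<in> I\<close> by (simp add: vanishing_iff)
    qed
    show "f \<oplus>\<^bsub>R\<^esub> g \<in> I" if "f \<in> I" "g \<in> I" for f g
    proof -
      have "eval_psigma K a (f \<oplus>\<^bsub>R\<^esub> g) = \<zero>\<^bsub>K\<^esub>" if a: "a \<in> V K" for K a
      proof -
        interpret ring_hom_cring R K "eval_psigma K a" using a by (rule eval_point_hom)
        show ?thesis using \<open>f \<in> I\<close> \<open>g \<in> I\<close> a by (auto simp: vanishing_iff)
      qed
      then show ?thesis using that by (simp add: vanishing_iff)
    qed
  qed (auto simp: vanishing_iff)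
  show mult: "g \<otimes>\<^bsub>R\<^esub> f \<in> I" if "f \<in> I" "g \<in> carrier R" for f g
  proof -
    have "eval_psigma K a (g \<otimes>\<^bsub>R\<^esub> f) = \<zero>\<^bsub>K\<^esub>" if a: "a \<in> V K" for K a
    proof -
      interpret ring_hom_cring R K "eval_psigma K a" using a by (rule eval_point_hom)
      show ?thesis using \<open>f \<in> I\<close> \<open>g \<in> carrier R\<close> a by (auto simp: vanishing_iff)
    qed
    then show ?thesis using that by (simp add: vanishing_iff)
  qed
  show "f \<otimes>\<^bsub>R\<^esub> g \<in> I" if "f \<in> I" "g \<in> carrier R" for f g
    using mult[OF that] that by (simp add: R.m_comm vanishing_iff)
qed

lemma carrier_coord_ring: "carrier (coord_ring \<sigma> m V) = cls ` carrier R"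
  by (auto simp: coord_ring_def psigma_quotient_simps carrier_Quot cls_def)

lemma eval_coord_cls:
  assumes a: "a \<in> V K" and f: "f \<in> carrier R"
  shows "eval_coord K a (cls f) = eval_psigma K a f"
proof -
  interpret ring_hom_cring R K "eval_psigma K a" using a by (rule eval_point_hom)
  have *: "eval_psigma K a g = eval_psigma K a f" if "g \<in> cls f" for g
    using that f a by (auto simp: cls_def a_r_coset_def' vanishing_iff)
  have "f \<in> cls f"
    unfolding cls_def using f by (rule I.a_rcos_self)
  then have "cls f \<noteq> {}" by blast
  then show ?thesis
    unfolding eval_coord_def by (rule the_elem_image_unique) (rule *)
qed

text \<open>I is cut out by points, so points separate the elements of the coordinate ring. Later
  identities between classes are reduced to values by this.\<close>

lemma cls_eq_iff:
  assumes f: "f \<in> carrier R" and g: "g \<in> carrier R"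
  shows "cls f = cls g \<longleftrightarrow> (\<forall>K. \<forall>a\<in>V K. eval_psigma K a f = eval_psigma K a g)"
proof
  assume "cls f = cls g"
  then show "\<forall>K. \<forall>a\<in>V K. eval_psigma K a f = eval_psigma K a g"
    using f g by (metis eval_coord_cls)
next
  assume *: "\<forall>K. \<forall>a\<in>V K. eval_psigma K a f = eval_psigma K a g"
  have "eval_psigma K a (f \<ominus>\<^bsub>R\<^esub> g) = \<zero>\<^bsub>K\<^esub>" if a: "a \<in> V K" for K a
  proof -
    interpret ring_hom_cring R K "eval_psigma K a" using a by (rule eval_point_hom)
    show ?thesis using f g a * by (auto simp: R.minus_eq S.r_neg)
  qed
  then show "cls f = cls g"
    unfolding cls_def using f g
    by (subst R.quotient_eq_iff_same_a_r_cos[OF I.is_ideal, symmetric]) (auto simp: vanishing_iff)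
qed

lemma cls_zero: "cls \<zero>\<^bsub>R\<^esub> = I"
  unfolding cls_def by (rule I.a_rcos_const) (rule I.zero_closed)

text \<open>P[\<sigma>]-primality is defined in the polynomial ring, so primes of k{V} are handled
  through their preimages there.\<close>

definition preim :: "((nat \<Rightarrow>\<^sub>0 int poly) \<Rightarrow>\<^sub>0 'k) set set \<Rightarrow> ((nat \<Rightarrow>\<^sub>0 int poly) \<Rightarrow>\<^sub>0 'k) set" where
  "preim p = {f \<in> carrier R. cls f \<in> p}"

lemma spectrum_iff:
  "p \<in> psigma_spectrum \<sigma> m V \<longleftrightarrow> p \<subseteq> cls ` carrier R \<and> psigma_prime \<sigma> m (preim p)"
  by (simp add: psigma_spectrum_def carrier_coord_ring preim_def cls_def)

lemma preim_primeideal: "p \<in> psigma_spectrum \<sigma> m V \<Longrightarrow> primeideal (preim p) R"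
  by (simp add: spectrum_iff psigma_prime_def)

text \<open>The kernel of evaluation contains I, so passing to classes and back loses nothing. Each
  point supplies a prime, which is enough to detect whether a function vanishes on V.\<close>

lemma point_in_spectrum:
  assumes a: "a \<in> V K"
  defines "p \<equiv> cls ` {f \<in> carrier R. eval_psigma K a f = \<zero>\<^bsub>K\<^esub>}"
  shows "p \<in> psigma_spectrum \<sigma> m V" "preim p = {f \<in> carrier R. eval_psigma K a f = \<zero>\<^bsub>K\<^esub>}"
proof -
  show *: "preim p = {f \<in> carrier R. eval_psigma K a f = \<zero>\<^bsub>K\<^esub>}"
    using a by (auto simp: preim_def p_def cls_eq_iff)
  show "p \<in> psigma_spectrum \<sigma> m V"
    unfolding spectrum_iff * using sigma_ext.psigma_prime_eval_kernel[OF point_sigma_ext[OF a] \<sigma> point_Pi[OF a]]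
    by (auto simp: p_def)
qed

definition basic_open :: "((nat \<Rightarrow>\<^sub>0 int poly) \<Rightarrow>\<^sub>0 'k) set \<Rightarrow> ((nat \<Rightarrow>\<^sub>0 int poly) \<Rightarrow>\<^sub>0 'k) set set set" where
  "basic_open F = {p \<in> psigma_spectrum \<sigma> m V. \<not> F \<subseteq> preim p}"

text \<open>A set of classes and its preimage in R cut out the same primes, so open sets can be
  described by sets of polynomials.\<close>

lemma open_pred_iff:
  "(\<exists>F. F \<subseteq> carrier (coord_ring \<sigma> m V) \<and> U = psigma_spectrum \<sigma> m V - {p \<in> psigma_spectrum \<sigma> m V. F \<subseteq> p})
    \<longleftrightarrow> (\<exists>F. F \<subseteq> carrier R \<and> U = basic_open F)"
proof
  assume "\<exists>F. F \<subseteq> carrier (coord_ring \<sigma> m V) \<and> U = psigma_spectrum \<sigma> m V - {p \<in> psigma_spectrum \<sigma> m V. F \<subseteq> p}"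
  then obtain F where F: "F \<subseteq> cls ` carrier R" "U = psigma_spectrum \<sigma> m V - {p \<in> psigma_spectrum \<sigma> m V. F \<subseteq> p}"
    by (auto simp: carrier_coord_ring)
  then have "U = basic_open {f \<in> carrier R. cls f \<in> F}"
    by (auto simp: basic_open_def preim_def)
  moreover have "{f \<in> carrier R. cls f \<in> F} \<subseteq> carrier R" by blast
  ultimately show "\<exists>F. F \<subseteq> carrier R \<and> U = basic_open F" by blast
next
  assume "\<exists>F. F \<subseteq> carrier R \<and> U = basic_open F"
  then obtain F where F: "F \<subseteq> carrier R" "U = basic_open F" by blast
  then have "U = psigma_spectrum \<sigma> m V - {p \<in> psigma_spectrum \<sigma> m V. cls ` F \<subseteq> p}"
    by (auto simp: basic_open_def preim_def)
  moreover have "cls ` F \<subseteq> carrier (coord_ring \<sigma> m V)"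
    using F by (auto simp: carrier_coord_ring)
  ultimately show "\<exists>F. F \<subseteq> carrier (coord_ring \<sigma> m V) \<and> U = psigma_spectrum \<sigma> m V - {p \<in> psigma_spectrum \<sigma> m V. F \<subseteq> p}"
    by blast
qed

text \<open>If f and g lie outside the prime, so does their product; conversely a product outside an
  ideal has both factors outside.\<close>

lemma basic_open_Int:
  assumes "F \<subseteq> carrier R" "G \<subseteq> carrier R"
  shows "basic_open F \<inter> basic_open G = basic_open {f \<otimes>\<^bsub>R\<^esub> g | f g. f \<in> F \<and> g \<in> G}"
proof -
  have "\<not> {f \<otimes>\<^bsub>R\<^esub> g | f g. f \<in> F \<and> g \<in> G} \<subseteq> preim p \<longleftrightarrow> \<not> F \<subseteq> preim p \<and> \<not> G \<subseteq> preim p"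
    if "p \<in> psigma_spectrum \<sigma> m V" for p
  proof -
    interpret P: primeideal "preim p" R using that by (rule preim_primeideal)
    have "f \<otimes>\<^bsub>R\<^esub> g \<in> preim p \<longleftrightarrow> f \<in> preim p \<or> g \<in> preim p" if "f \<in> F" "g \<in> G" for f g
      using that assms P.I_prime P.I_l_closed P.I_r_closed by blast
    then show ?thesis by blast
  qed
  then show ?thesis
    unfolding basic_open_def by blast
qed

text \<open>\<open>topology\<close> returns the intended open sets only once they are known to form
  a topology. Intersections come from products, unions from unions of defining sets.\<close>

lemma openin_space: "openin (psigma_space \<sigma> m V) U \<longleftrightarrow> (\<exists>F. F \<subseteq> carrier R \<and> U = basic_open F)"
proof -
  have "istopology (\<lambda>U. \<exists>F. F \<subseteq> carrier R \<and> U = basic_open F)"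
    unfolding istopology_def
  proof (intro conjI allI impI)
    fix U U' assume "\<exists>F. F \<subseteq> carrier R \<and> U = basic_open F" "\<exists>F. F \<subseteq> carrier R \<and> U' = basic_open F"
    then obtain F G where FG: "F \<subseteq> carrier R" "G \<subseteq> carrier R" "U = basic_open F" "U' = basic_open G" by blast
    then have "{f \<otimes>\<^bsub>R\<^esub> g | f g. f \<in> F \<and> g \<in> G} \<subseteq> carrier R" by auto
    then show "\<exists>F. F \<subseteq> carrier R \<and> U \<inter> U' = basic_open F"
      unfolding FG(3,4) basic_open_Int[OF FG(1,2)] by blast
  next
    fix \<U> assume "\<forall>U\<in>\<U>. \<exists>F. F \<subseteq> carrier R \<and> U = basic_open F"
    then obtain F where F: "\<And>U. U \<in> \<U> \<Longrightarrow> F U \<subseteq> carrier R \<and> U = basic_open (F U)" by metis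
    have "\<Union>\<U> = (\<Union>U\<in>\<U>. basic_open (F U))"
      using F by auto
    also have "\<dots> = basic_open (\<Union>U\<in>\<U>. F U)"
      by (auto simp: basic_open_def)
    finally show "\<exists>F. F \<subseteq> carrier R \<and> \<Union>\<U> = basic_open F"
      using F by (intro exI[of _ "\<Union>U\<in>\<U>. F U"]) auto
  qed
  then show ?thesis
    unfolding psigma_space_def open_pred_iff by (subst topology_inverse') simp_all
qed

text \<open>1 lies in no prime, so the whole spectrum is itself a basic open set.\<close>

lemma topspace_space: "topspace (psigma_space \<sigma> m V) = psigma_spectrum \<sigma> m V"
proof -
  have "\<one>\<^bsub>R\<^esub> \<notin> preim p" if "p \<in> psigma_spectrum \<sigma> m V" for p
  proof -
    interpret primeideal "preim p" R using that by (rule preim_primeideal)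
    show ?thesis using one_imp_carrier I_notcarr by blast
  qed
  then have "basic_open {\<one>\<^bsub>R\<^esub>} = psigma_spectrum \<sigma> m V"
    by (auto simp: basic_open_def)
  then have "openin (psigma_space \<sigma> m V) (psigma_spectrum \<sigma> m V)"
    unfolding openin_space by (intro exI[of _ "{\<one>\<^bsub>R\<^esub>}"]) simp
  moreover have "U \<subseteq> psigma_spectrum \<sigma> m V" if "openin (psigma_space \<sigma> m V) U" for U
    using that by (auto simp: openin_space basic_open_def)
  ultimately show ?thesis
    by (intro subset_antisym) (auto dest: openin_subset)
qed

lemma vanishing_on_open:
  assumes irr: "irreducible_space (psigma_space \<sigma> m V)"
    and U: "openin (psigma_space \<sigma> m V) U" "U \<noteq> {}"
    and f: "f \<in> carrier R" "\<And>p. p \<in> U \<Longrightarrow> f \<in> preim p"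
  shows "f \<in> I"
proof -
  have "openin (psigma_space \<sigma> m V) (basic_open {f})"
    using f by (auto simp: openin_space)
  have sub: "U \<subseteq> topspace (psigma_space \<sigma> m V)" "basic_open {f} \<subseteq> topspace (psigma_space \<sigma> m V)"
    using U(1) \<open>openin _ (basic_open {f})\<close> by (auto dest: openin_subset)
  have "closedin (psigma_space \<sigma> m V) (topspace (psigma_space \<sigma> m V) - U)"
    "closedin (psigma_space \<sigma> m V) (topspace (psigma_space \<sigma> m V) - basic_open {f})"
    using U(1) \<open>openin _ (basic_open {f})\<close> by auto
  \<comment> \<open>By \<open>f(2)\<close>, U misses \<open>basic_open {f}\<close>, so the two
    closed complements cover the space. One of them is everything, and it is not the complement of
    the nonempty U.\<close>
  moreover have "topspace (psigma_space \<sigma> m V) =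
      (topspace (psigma_space \<sigma> m V) - U) \<union> (topspace (psigma_space \<sigma> m V) - basic_open {f})"
    using f(2) by (auto simp: basic_open_def)
  ultimately have "topspace (psigma_space \<sigma> m V) - U = topspace (psigma_space \<sigma> m V) \<or>
      topspace (psigma_space \<sigma> m V) - basic_open {f} = topspace (psigma_space \<sigma> m V)"
    using irr unfolding irreducible_space_def by blast
  then have empty: "basic_open {f} = {}"
    using U(2) sub by blast
  have "eval_psigma K a f = \<zero>\<^bsub>K\<^esub>" if a: "a \<in> V K" for K a
  proof -
    have "f \<in> preim (cls ` {f \<in> carrier R. eval_psigma K a f = \<zero>\<^bsub>K\<^esub>})"
      using empty point_in_spectrum(1)[OF a] by (auto simp: basic_open_def)
    then show ?thesis
      unfolding point_in_spectrum(2)[OF a] by simp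
  qed
  then show ?thesis
    using f(1) by (simp add: vanishing_iff)
qed

end

context affine_variety
begin

text \<open>Evaluation commutes with \<sigma>, so polynomials that agree at all points have images
  that agree at all points; thus \<sigma> is well defined on classes.\<close>

lemma coord_sig:
  assumes f: "f \<in> carrier R"
  shows "sig (coord_ring \<sigma> m V) (cls f) = cls (sig R f)"
proof -
  have sigR: "sig R g \<in> carrier R" if "g \<in> carrier R" for g
    using that psigma_poly_sig(1)[OF \<sigma>] by (simp add: psigma_poly_simps(1))
  have *: "I +>\<^bsub>R\<^esub> sig R g = cls (sig R f)" if g: "g \<in> cls f" for g
  proof -
    have gR: "g \<in> carrier R"
      using g R.a_r_coset_subset_G[OF I.a_subset f] by (auto simp: cls_def)
    have "cls g = cls f"
      using g f unfolding cls_def by (metis I.a_repr_independence')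
    then have "eval_psigma K a g = eval_psigma K a f" if "a \<in> V K" for K a
      using cls_eq_iff[OF gR f] that by blast
    then have "eval_psigma K a (sig R g) = eval_psigma K a (sig R f)" if "a \<in> V K" for K a
      using that f gR sigma_ext.eval_sig[OF point_sigma_ext point_Pi \<sigma>] by (simp add: psigma_poly_simps(1))
    then show ?thesis
      using cls_eq_iff[OF sigR[OF gR] sigR[OF f]] by (simp add: cls_def)
  qed
  have "cls f \<noteq> {}"
    using I.a_rcos_self[OF f] by (auto simp: cls_def)
  then have "(\<Union>g\<in>cls f. I +>\<^bsub>R\<^esub> sig R g) = cls (sig R f)"
    by (rule SUP_eq_const) (rule *)
  then show ?thesis
    by (simp only: coord_ring_def psigma_quotient_simps)
qed

lemma cls_ring_hom: "cls \<in> ring_hom R (coord_ring \<sigma> m V)"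
proof -
  have "cls = (+>\<^bsub>R\<^esub>) I" by (simp add: fun_eq_iff cls_def)
  then show ?thesis
    using I.rcos_ring_hom by (simp add: ring_hom_def coord_ring_def psigma_quotient_simps)
qed

lemma eval_coord_hom:
  assumes a: "a \<in> V K"
  shows "eval_coord K a \<in> ring_hom (coord_ring \<sigma> m V) K"
proof -
  interpret ring_hom_cring R K "eval_psigma K a" using a by (rule eval_point_hom)
  show ?thesis
    unfolding ring_hom_def carrier_coord_ring
    using ring_hom_mult[OF cls_ring_hom, symmetric] ring_hom_add[OF cls_ring_hom, symmetric]
      ring_hom_one[OF cls_ring_hom, symmetric]
    by (auto simp: eval_coord_cls[OF a])
qed

lemma eval_coord_sig:
  assumes a: "a \<in> V K" and C: "C \<in> carrier (coord_ring \<sigma> m V)"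
  shows "eval_coord K a (sig (coord_ring \<sigma> m V) C) = sig K (eval_coord K a C)"
proof -
  obtain f where f: "f \<in> carrier R" "C = cls f"
    using C by (auto simp: carrier_coord_ring)
  then have "sig R f \<in> carrier R"
    using psigma_poly_sig(1)[OF \<sigma>] by (simp add: psigma_poly_simps(1))
  then show ?thesis
    using f sigma_ext.eval_sig[OF point_sigma_ext point_Pi \<sigma>, OF a a]
    by (simp add: coord_sig eval_coord_cls[OF a] psigma_poly_simps(1))
qed

lemma eval_coord_smap:
  assumes a: "a \<in> V K"
  shows "eval_coord K a (smap (coord_ring \<sigma> m V) c) = smap K c"
proof -
  interpret K: sigma_ext K \<sigma> using a by (rule point_sigma_ext)
  have *: "smap (coord_ring \<sigma> m V) c = cls (Poly_Mapping.single 0 c)"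
    by (simp add: coord_ring_def psigma_quotient_simps cls_def psigma_poly_simps(6))
  have "Poly_Mapping.single 0 c \<in> carrier R"
    by (simp add: psigma_poly_simps(1))
  then show ?thesis
    unfolding * by (simp add: eval_coord_cls[OF a] K.eval_single[OF point_Pi[OF a]] K.eval_mono_0)
qed

end

text \<open>With \<open>k\<close> as a record, \<open>d\<^sup>u\<close> for \<open>d \<in> k\<^sup>m\<close> is an instance of \<^const>\<open>eval_mono\<close>.\<close>

definition base_field :: "('k::field_char_0 \<Rightarrow> 'k) \<Rightarrow> ('k, 'k) sigma_algebra" where
  "base_field \<sigma> = \<lparr>carrier = UNIV, monoid.mult = (*), one = 1, zero = 0, add = (+), sig = \<sigma>, smap = id\<rparr>"

lemma base_field_simps [simp]:
  "carrier (base_field \<sigma>) = UNIV" "c \<otimes>\<^bsub>base_field \<sigma>\<^esub> d = c * d" "c \<oplus>\<^bsub>base_field \<sigma>\<^esub> d = c + d"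
  "\<one>\<^bsub>base_field \<sigma>\<^esub> = 1" "\<zero>\<^bsub>base_field \<sigma>\<^esub> = 0" "sig (base_field \<sigma>) = \<sigma>" "smap (base_field \<sigma>) = id"
  by (simp_all add: base_field_def)

lemma base_field_ext:
  assumes "sigma_field \<sigma>"
  shows "sigma_ext (base_field \<sigma>) \<sigma>"
proof -
  have "cring (base_field \<sigma>)"
  proof (rule cringI)
    show "abelian_group (base_field \<sigma>)"
    proof (rule abelian_groupI; simp?)
      show "\<exists>y. y + x = 0" for x :: 'a by (rule exI[of _ "-x"]) simp
    qed
    show "comm_monoid (base_field \<sigma>)"
      by (rule comm_monoidI) (simp_all add: ac_simps)
  qed (simp add: distrib_right)
  then have "field (base_field \<sigma>)"
  proof (rule cring.cring_fieldI2)
    show "\<exists>b\<in>carrier (base_field \<sigma>). c \<otimes>\<^bsub>base_field \<sigma>\<^esub> b = \<one>\<^bsub>base_field \<sigma>\<^esub>"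
      if "c \<noteq> \<zero>\<^bsub>base_field \<sigma>\<^esub>" for c
      using that by (intro bexI[of _ "inverse c"]) auto
  qed simp
  moreover have "id \<in> ring_hom ring_of_type_algebra (base_field \<sigma>)" "\<sigma> \<in> ring_hom (base_field \<sigma>) (base_field \<sigma>)"
    using sigma_field_simps[OF assms] by (auto simp: ring_hom_def ring_of_type_algebra_def)
  ultimately show ?thesis
    by (simp add: sigma_ext_def sigma_ext_axioms_def sigma_field_ext_def)
qed

section \<open>Characters\<close>

text \<open>A K-point of the torus, recorded as the homomorphism that it induces on k[M]. Keeping
  all of k[M], and not only the characters \<chi>^w, lets coefficients and exponents be raised to
  powers together.\<close>

locale character_point = sigma_ext K \<sigma> + lat: Modules.module scale
  for K :: "('u, 'k::field_char_0) sigma_algebra" (structure) and \<sigma>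
    and scale :: "int poly \<Rightarrow> 'm::ab_group_add \<Rightarrow> 'm" +
  fixes M :: "'m set" and \<psi> :: "('m \<Rightarrow>\<^sub>0 'k) \<Rightarrow> 'u"
  assumes \<sigma>: "sigma_field \<sigma>" and M: "lat.subspace M"
    and \<psi>_hom: "\<psi> \<in> ring_hom (monoid_algebra \<sigma> scale M) K"
    and \<psi>_sig: "Poly_Mapping.keys f \<subseteq> M \<Longrightarrow> \<psi> (sig (monoid_algebra \<sigma> scale M) f) = sig K (\<psi> f)"
    and \<psi>_smap: "\<psi> (Poly_Mapping.single 0 c) = smap K c"
begin

lemma \<psi>_closed: "Poly_Mapping.keys f \<subseteq> M \<Longrightarrow> \<psi> f \<in> carrier K"
  and \<psi>_mult: "Poly_Mapping.keys f \<subseteq> M \<Longrightarrow> Poly_Mapping.keys g \<subseteq> M \<Longrightarrow> \<psi> (f * g) = \<psi> f \<otimes> \<psi> g"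
  and \<psi>_add: "Poly_Mapping.keys f \<subseteq> M \<Longrightarrow> Poly_Mapping.keys g \<subseteq> M \<Longrightarrow> \<psi> (f + g) = \<psi> f \<oplus> \<psi> g"
  and \<psi>_one: "\<psi> 1 = \<one>"
  using \<psi>_hom by (auto simp: ring_hom_def monoid_algebra_simps)

lemma \<psi>_zero: "\<psi> 0 = \<zero>"
  using \<psi>_smap[of 0] by simp

lemma \<psi>_single_closed: "w \<in> M \<Longrightarrow> \<psi> (Poly_Mapping.single w c) \<in> carrier K"
  by (rule \<psi>_closed) auto

lemma \<psi>_single_mult:
  "v \<in> M \<Longrightarrow> w \<in> M \<Longrightarrow>
    \<psi> (Poly_Mapping.single (v + w) (c * d)) = \<psi> (Poly_Mapping.single v c) \<otimes> \<psi> (Poly_Mapping.single w d)"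
  by (subst \<psi>_mult[symmetric]) (auto simp: mult_single)

lemma \<psi>_single_sig:
  "w \<in> M \<Longrightarrow> \<psi> (Poly_Mapping.single (scale [:0, 1:] w) (\<sigma> c)) = sig K (\<psi> (Poly_Mapping.single w c))"
  by (subst \<psi>_sig[symmetric]) (auto simp: monoid_algebra_simps push_single sigma_field_simps[OF \<sigma>])

text \<open>M contains -w, so a nonzero term is invertible in k[M] and its image is a unit.\<close>

lemma \<psi>_single_Units:
  assumes "w \<in> M" "c \<noteq> 0"
  shows "\<psi> (Poly_Mapping.single w c) \<in> Units K"
proof -
  have "\<psi> (Poly_Mapping.single w c) \<otimes> \<psi> (Poly_Mapping.single (- w) (inverse c)) = \<one>"
    using assms M by (subst \<psi>_single_mult[symmetric]) (auto simp: lat.subspace_neg \<psi>_one)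
  then show ?thesis
    using assms M \<psi>_single_closed nonzero_Units by (metis l_null lat.subspace_neg zero_not_one)
qed

text \<open>For c nonzero, g |-> \<psi>(c^g \<chi>^(g w)) meets the hypotheses of
  \<open>Zx_power_unique\<close>, so it is the power of its value at 1. For c = 0 both sides are 1
  if g = 0, and 0 otherwise.\<close>

lemma Zx_power_character:
  assumes w: "w \<in> M"
  shows "Zx_power K (\<psi> (Poly_Mapping.single w c)) g =
    \<psi> (Poly_Mapping.single (scale g w) (Zx_power (base_field \<sigma>) c g))"
proof -
  interpret k: sigma_ext "base_field \<sigma>" \<sigma>
    using \<sigma> by (rule base_field_ext)
  show ?thesis
  proof (cases "c = 0")
    case True
    then show ?thesis
      using k.Zx_power_zero_base[of g] by (simp add: Zx_power_zero_base \<psi>_zero \<psi>_one)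
  next
    case False
    then have c: "c \<in> Units (base_field \<sigma>)"
      by (simp add: k.nonzero_Units)
    define F where "F g = \<psi> (Poly_Mapping.single (scale g w) (Zx_power (base_field \<sigma>) c g))" for g
    have "F g = Zx_power K (F 1) g"
    proof (rule Zx_power_unique)
      show "F g \<in> Units K" for g
        using k.Zx_power_Units[OF c, of g] w M
        by (auto simp: F_def k.nonzero_Units lat.subspace_scale intro!: \<psi>_single_Units)
      show "F (g + h) = F g \<otimes> F h" for g h
        using k.Zx_power_add_Units[OF c, of g h] w M
        by (auto simp: F_def lat.scale_left_distrib lat.subspace_scale \<psi>_single_mult)
      show "F ([:0, 1:] * g) = sig K (F g)" for g
        using k.Zx_power_x[of c g] w M
        by (auto simp: F_def lat.subspace_scale simp flip: \<psi>_single_sig lat.scale_scale simp del: mult_pCons_left)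
    qed
    then show ?thesis
      using k.Zx_power_1[of c] by (simp add: F_def)
  qed
qed

lemma finprod_characters:
  "finite A \<Longrightarrow> (\<And>i. i \<in> A \<Longrightarrow> x i \<in> M) \<Longrightarrow>
    finprod K (\<lambda>i. \<psi> (Poly_Mapping.single (x i) (y i))) A =
      \<psi> (Poly_Mapping.single (\<Sum>i\<in>A. x i) (finprod (base_field \<sigma>) y A))"
proof (induction A rule: finite_induct)
  case empty
  interpret k: sigma_ext "base_field \<sigma>" \<sigma>
    using \<sigma> by (rule base_field_ext)
  show ?case by (simp add: \<psi>_one)
next
  case (insert i A)
  interpret k: sigma_ext "base_field \<sigma>" \<sigma>
    using \<sigma> by (rule base_field_ext)
  have "(\<Sum>i\<in>A. x i) \<in> M"
    using insert M by (intro lat.subspace_sum) auto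
  then show ?case
    using insert by (subst finprod_insert) (auto simp: \<psi>_single_closed \<psi>_single_mult)
qed

lemma eval_mono_character:
  assumes w: "\<And>i. i < m \<Longrightarrow> w i \<in> M"
    and a: "\<And>i. i < m \<Longrightarrow> a i = \<psi> (Poly_Mapping.single (w i) (d i))"
    and u: "u \<in> Zx_pow m"
  shows "eval_mono K a u =
    \<psi> (Poly_Mapping.single (\<Sum>i<m. scale (Poly_Mapping.lookup u i) (w i)) (eval_mono (base_field \<sigma>) d u))"
proof -
  interpret k: sigma_ext "base_field \<sigma>" \<sigma>
    using \<sigma> by (rule base_field_ext)
  have "a \<in> {..<m} \<rightarrow> carrier K"
    using w a by (auto simp: \<psi>_single_closed)
  then have "eval_mono K a u = finprod K (\<lambda>i. Zx_power K (a i) (Poly_Mapping.lookup u i)) {..<m}"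
    using u by (rule eval_mono_eq)
  also have "\<dots> = finprod K (\<lambda>i. \<psi> (Poly_Mapping.single (scale (Poly_Mapping.lookup u i) (w i))
      (Zx_power (base_field \<sigma>) (d i) (Poly_Mapping.lookup u i)))) {..<m}"
    using w M by (intro finprod_cong') (auto simp: a Zx_power_character intro!: \<psi>_single_closed lat.subspace_scale)
  also have "\<dots> = \<psi> (Poly_Mapping.single (\<Sum>i<m. scale (Poly_Mapping.lookup u i) (w i))
      (finprod (base_field \<sigma>) (\<lambda>i. Zx_power (base_field \<sigma>) (d i) (Poly_Mapping.lookup u i)) {..<m}))"
    using w M by (intro finprod_characters) (auto intro: lat.subspace_scale)
  also have "finprod (base_field \<sigma>) (\<lambda>i. Zx_power (base_field \<sigma>) (d i) (Poly_Mapping.lookup u i)) {..<m} =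
      eval_mono (base_field \<sigma>) d u"
    using u by (subst k.eval_mono_eq) auto
  finally show ?thesis .
qed

text \<open>Both sides are additive in f, so terms suffice, and there it is the monomial formula
  scaled by c. Restricting f to the torus thus amounts to forming an explicit element of
  k[M].\<close>

lemma eval_psigma_character:
  assumes w: "\<And>i. i < m \<Longrightarrow> w i \<in> M"
    and a: "\<And>i. i < m \<Longrightarrow> a i = \<psi> (Poly_Mapping.single (w i) (d i))"
    and f: "Poly_Mapping.keys f \<subseteq> Px_pow m"
  shows "eval_psigma K a f =
    \<psi> (push (\<lambda>u. \<Sum>i<m. scale (Poly_Mapping.lookup u i) (w i)) (\<lambda>u c. c * eval_mono (base_field \<sigma>) d u) f)"
    (is "_ = \<psi> (push ?E ?\<tau> f)")
proof -
  have pt: "a \<in> {..<m} \<rightarrow> carrier K"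
    using w a by (auto simp: \<psi>_single_closed)
  have E: "?E u \<in> M" for u
    using w M by (intro lat.subspace_sum lat.subspace_scale) auto
  have keys: "Poly_Mapping.keys (push ?E ?\<tau> g) \<subseteq> M" for g
    using E by (intro keys_push[of g UNIV]) auto
  show ?thesis
    using f
  proof (induction f rule: keys_subset_induct)
    case (single u c)
    \<comment> \<open>The term is split into c \<chi>^0 and d^u \<chi>^(E u), so that
      \<open>\<psi>_smap\<close> takes care of c.\<close>
    have "\<psi> (Poly_Mapping.single (0 + ?E u) (?\<tau> u c)) = smap K c \<otimes> eval_mono K a u"
      using E M single eval_mono_character[OF w a, where u = u and m = m]
      by (subst \<psi>_single_mult) (auto simp: \<psi>_smap Px_pow_Zx_pow lat.subspace_0)
    then show ?case
      using single by (simp add: eval_single[OF pt] push_single)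
  next
    case (add f g)
    have "push ?E ?\<tau> (f + g) = push ?E ?\<tau> f + push ?E ?\<tau> g"
      by (rule push_add) (auto simp: distrib_right)
    then show ?case
      using add keys by (simp add: eval_add[OF pt] \<psi>_add)
  qed (simp add: \<psi>_zero eval_zero[OF pt])
qed

end

section \<open>Finitely generated P[x]-semimodules\<close>

lemma Zx_scale_sum_left: "Zx_scale (sum g A) u = (\<Sum>i\<in>A. Zx_scale (g i) u)"
  by (auto intro!: poly_mapping_eqI simp: lookup_Zx_scale lookup_sum sum_distrib_right)

lemma Zx_pow_scale: "u \<in> Zx_pow n \<Longrightarrow> Zx_scale g u \<in> Zx_pow n"
  by (auto simp: Zx_pow_def in_keys_iff lookup_Zx_scale subset_iff)

lemma Zx_pow_sum: "(\<And>i. i \<in> A \<Longrightarrow> w i \<in> Zx_pow n) \<Longrightarrow> sum w A \<in> Zx_pow n"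
  using keys_sum[of w A] by (fastforce simp: Zx_pow_def)

text \<open>\<open>affine_Px_semimodule\<close> asks for a finite set of generators, whereas the
  exponents of the coordinates form a family that may repeat. Equal generators are merged by adding
  their coefficients, which stays inside P[x].\<close>

lemma affine_Px_semimodule_span:
  assumes J: "finite J" and v: "\<And>i. i \<in> J \<Longrightarrow> v i \<in> Zx_pow N"
  shows "affine_Px_semimodule N {\<Sum>i\<in>J. Zx_scale (g i) (v i) | g. g ` J \<subseteq> Px}" (is "affine_Px_semimodule N ?S")
proof -
  have "Px_semimodule N ?S"
    unfolding Px_semimodule_def
  proof (intro conjI ballI)
    show "?S \<subseteq> Zx_pow N"
      using v by (auto intro!: Zx_pow_sum Zx_pow_scale)
  next
    fix a b assume "a \<in> ?S" "b \<in> ?S"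
    then obtain g h where gh: "a = (\<Sum>i\<in>J. Zx_scale (g i) (v i))" "b = (\<Sum>i\<in>J. Zx_scale (h i) (v i))"
      "g ` J \<subseteq> Px" "h ` J \<subseteq> Px" by blast
    then have "a + b = (\<Sum>i\<in>J. Zx_scale (g i + h i) (v i))"
      by (simp add: Zx_scale_add_left sum.distrib)
    moreover have "(\<lambda>i. g i + h i) ` J \<subseteq> Px"
      using gh by (auto intro: Px_add)
    ultimately show "a + b \<in> ?S"
      by (intro CollectI exI[of _ "\<lambda>i. g i + h i"] conjI)
  next
    fix p a assume p: "p \<in> Px" and "a \<in> ?S"
    then obtain g where g: "a = (\<Sum>i\<in>J. Zx_scale (g i) (v i))" "g ` J \<subseteq> Px" by blast
    then have "Zx_scale p a = (\<Sum>i\<in>J. Zx_scale (p * g i) (v i))"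
      by (simp add: Zx_scale_sum Zx_scale_scale)
    moreover have "(\<lambda>i. p * g i) ` J \<subseteq> Px"
      using g p by (auto intro: Px_mult)
    ultimately show "Zx_scale p a \<in> ?S"
      by (intro CollectI exI[of _ "\<lambda>i. p * g i"] conjI)
  qed
  moreover have "?S = {\<Sum>u\<in>v ` J. Zx_scale (g u) u | g. g ` (v ` J) \<subseteq> Px}" (is "_ = ?S'")
  proof
    show "?S \<subseteq> ?S'"
    proof
      fix a assume "a \<in> ?S"
      then obtain g where g: "a = (\<Sum>i\<in>J. Zx_scale (g i) (v i))" "g ` J \<subseteq> Px" by blast
      define h where "h u = (\<Sum>i\<in>{i \<in> J. v i = u}. g i)" for u
      have "a = (\<Sum>u\<in>v ` J. \<Sum>i\<in>{i \<in> J. v i = u}. Zx_scale (g i) (v i))"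
        unfolding g(1) using J by (rule sum.image_gen)
      also have "\<dots> = (\<Sum>u\<in>v ` J. Zx_scale (h u) u)"
        by (simp add: h_def Zx_scale_sum_left)
      finally have "a = (\<Sum>u\<in>v ` J. Zx_scale (h u) u)" .
      moreover have "h ` (v ` J) \<subseteq> Px"
        unfolding h_def using g(2) by (auto intro!: Px_sum)
      ultimately show "a \<in> ?S'"
        by (intro CollectI exI[of _ h] conjI)
    qed
    show "?S' \<subseteq> ?S"
    proof
      fix a assume "a \<in> ?S'"
      then obtain h where h: "a = (\<Sum>u\<in>v ` J. Zx_scale (h u) u)" "h ` (v ` J) \<subseteq> Px" by blast
      \<comment> \<open>One index is chosen for each generator; the remaining ones receive the
        coefficient 0, which belongs to P[x].\<close>
      obtain J' where J': "J' \<subseteq> J" "inj_on v J'" "v ` J = v ` J'"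
        using subset_image_inj[of "v ` J" v J] by blast
      define g where "g i = (if i \<in> J' then h (v i) else 0)" for i
      have "a = (\<Sum>i\<in>J'. Zx_scale (h (v i)) (v i))"
        unfolding h(1) J'(3) using J'(2) by (simp add: sum.reindex)
      also have "\<dots> = (\<Sum>i\<in>J. Zx_scale (g i) (v i))"
        using J J'(1) by (intro sum.mono_neutral_cong_left) (auto simp: g_def)
      finally have "a = (\<Sum>i\<in>J. Zx_scale (g i) (v i))" .
      moreover have "g ` J \<subseteq> Px"
        using h(2) by (auto simp: g_def)
      ultimately show "a \<in> ?S"
        by (intro CollectI exI[of _ g] conjI)
    qed
  qed
  moreover have "finite (v ` J)" "v ` J \<subseteq> Zx_pow N"
    using J v by auto
  ultimately show ?thesis
    unfolding affine_Px_semimodule_def by blast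
qed

section \<open>Toric parametrisations\<close>

text \<open>A zero coefficient \<open>d\<^sub>i\<close> discards the monomials divisible by \<open>y\<^sub>i\<close>.\<close>

locale toric_map =
  fixes \<sigma> :: "'k::field_char_0 \<Rightarrow> 'k" and m N :: nat
    and v :: "nat \<Rightarrow> (nat \<Rightarrow>\<^sub>0 int poly)" and d :: "nat \<Rightarrow> 'k"
  assumes \<sigma>: "sigma_field \<sigma>" and v: "\<And>i. i < m \<Longrightarrow> v i \<in> Zx_pow N"
begin

sublocale k: sigma_ext "base_field \<sigma>" \<sigma>
  using \<sigma> by (rule base_field_ext)

definition expo :: "(nat \<Rightarrow>\<^sub>0 int poly) \<Rightarrow> (nat \<Rightarrow>\<^sub>0 int poly)" where
  "expo u = (\<Sum>i<m. Zx_scale (Poly_Mapping.lookup u i) (v i))"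

definition coef :: "(nat \<Rightarrow>\<^sub>0 int poly) \<Rightarrow> 'k" where
  "coef u = eval_mono (base_field \<sigma>) d u"

definition \<Phi> :: "((nat \<Rightarrow>\<^sub>0 int poly) \<Rightarrow>\<^sub>0 'k) \<Rightarrow> ((nat \<Rightarrow>\<^sub>0 int poly) \<Rightarrow>\<^sub>0 'k)" where
  "\<Phi> = push expo (\<lambda>u c. c * coef u)"

text \<open>The exponents of the monomials that survive, which is the form needed to describe the
  image of \<Phi>; generators are recovered in \<open>S_eq\<close>.\<close>

definition S :: "(nat \<Rightarrow>\<^sub>0 int poly) set" where
  "S = expo ` {u \<in> Px_pow m. coef u \<noteq> 0}"

abbreviation B where "B \<equiv> monoid_algebra \<sigma> Zx_scale S"

lemma expo_0 [simp]: "expo 0 = 0"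
  and expo_add: "expo (u + u') = expo u + expo u'"
  and expo_scale: "expo (Zx_scale g u) = Zx_scale g (expo u)"
  by (simp_all add: expo_def lookup_add Zx_scale_add_left sum.distrib Zx_scale_sum Zx_scale_scale lookup_Zx_scale)

lemma d_Pi: "d \<in> {..<m} \<rightarrow> carrier (base_field \<sigma>)"
  by simp

lemma coef_0 [simp]: "coef 0 = 1"
  and coef_add: "u \<in> Px_pow m \<Longrightarrow> u' \<in> Px_pow m \<Longrightarrow> coef (u + u') = coef u * coef u'"
  and coef_x: "u \<in> Px_pow m \<Longrightarrow> coef (Zx_scale [:0, 1:] u) = \<sigma> (coef u)"
  and coef_nonzero: "u \<in> Px_pow m \<Longrightarrow> coef u \<noteq> 0 \<longleftrightarrow> (\<forall>i<m. d i = 0 \<longrightarrow> Poly_Mapping.lookup u i = 0)"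
  using k.eval_mono_0 k.eval_mono_add[OF d_Pi] k.eval_mono_x[OF d_Pi] k.eval_mono_eq_zero_iff[OF d_Pi, of u]
  by (auto simp: coef_def Px_pow_Zx_pow)

text \<open>A monomial survives exactly when it avoids every variable with d_i = 0, so only the
  \<open>v i\<close> with d_i nonzero contribute to its exponent.\<close>

lemma S_eq: "S = {\<Sum>i\<in>{i. i < m \<and> d i \<noteq> 0}. Zx_scale (g i) (v i) | g. g ` {i. i < m \<and> d i \<noteq> 0} \<subseteq> Px}"
proof (intro subset_antisym subsetI)
  fix w assume "w \<in> S"
  then obtain u where u: "u \<in> Px_pow m" "coef u \<noteq> 0" "w = expo u"
    by (auto simp: S_def)
  then have "w = (\<Sum>i\<in>{i. i < m \<and> d i \<noteq> 0}. Zx_scale (Poly_Mapping.lookup u i) (v i))"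
    unfolding u(3) expo_def by (intro sum.mono_neutral_right) (auto simp: coef_nonzero)
  moreover have "Poly_Mapping.lookup u ` {i. i < m \<and> d i \<noteq> 0} \<subseteq> Px"
    using u by (auto simp: Px_pow_def)
  ultimately show "w \<in> {\<Sum>i\<in>{i. i < m \<and> d i \<noteq> 0}. Zx_scale (g i) (v i) | g. g ` {i. i < m \<and> d i \<noteq> 0} \<subseteq> Px}"
    by (intro CollectI exI[of _ "Poly_Mapping.lookup u"] conjI)
next
  fix w assume "w \<in> {\<Sum>i\<in>{i. i < m \<and> d i \<noteq> 0}. Zx_scale (g i) (v i) | g. g ` {i. i < m \<and> d i \<noteq> 0} \<subseteq> Px}"
  then obtain g where g: "w = (\<Sum>i\<in>{i. i < m \<and> d i \<noteq> 0}. Zx_scale (g i) (v i))"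
    "g ` {i. i < m \<and> d i \<noteq> 0} \<subseteq> Px" by blast
  \<comment> \<open>The coefficients are extended by 0 to all indices; these zeros keep
    \<open>coef u\<close> nonzero.\<close>
  define u where "u = (\<Sum>i\<in>{i. i < m \<and> d i \<noteq> 0}. Poly_Mapping.single i (g i))"
  have lu: "Poly_Mapping.lookup u j = (if j < m \<and> d j \<noteq> 0 then g j else 0)" for j
    by (auto simp: u_def lookup_sum lookup_single when_def sum.delta)
  have "u \<in> Px_pow m"
    using g(2) by (auto simp: Px_pow_def Zx_pow_def in_keys_iff lu split: if_splits)
  moreover from this have "coef u \<noteq> 0"
    by (auto simp: coef_nonzero lu)
  moreover have "w = expo u"
    unfolding g(1) expo_def by (intro sum.mono_neutral_cong_left) (auto simp: lu)
  ultimately show "w \<in> S"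
    by (auto simp: S_def)
qed

lemma affine_S: "affine_Px_semimodule N S"
  unfolding S_eq by (rule affine_Px_semimodule_span) (auto intro: v)

lemma S_0: "0 \<in> S"
  unfolding S_def by (rule image_eqI[of _ _ 0]) auto

lemma S_add: "w \<in> S \<Longrightarrow> w' \<in> S \<Longrightarrow> w + w' \<in> S"
  using affine_S by (auto simp: affine_Px_semimodule_def Px_semimodule_def)

lemma keys_\<Phi>: "Poly_Mapping.keys f \<subseteq> Px_pow m \<Longrightarrow> Poly_Mapping.keys (\<Phi> f) \<subseteq> S"
  unfolding \<Phi>_def by (rule keys_push[where A = "Px_pow m"]) (auto simp: S_def)

lemma \<Phi>_single: "\<Phi> (Poly_Mapping.single u c) = Poly_Mapping.single (expo u) (c * coef u)"
  by (simp add: \<Phi>_def push_single)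

lemma \<Phi>_add: "\<Phi> (f + g) = \<Phi> f + \<Phi> g"
  unfolding \<Phi>_def by (rule push_add) (auto simp: distrib_right)

lemma \<Phi>_mult:
  "Poly_Mapping.keys f \<subseteq> Px_pow m \<Longrightarrow> Poly_Mapping.keys g \<subseteq> Px_pow m \<Longrightarrow> \<Phi> (f * g) = \<Phi> f * \<Phi> g"
  unfolding \<Phi>_def by (rule push_mult[where A = "Px_pow m"]) (auto simp: distrib_right expo_add coef_add)

lemma \<Phi>_ring_hom: "ring_hom_ring (psigma_poly \<sigma> m) B \<Phi>"
proof (rule ring_hom_ringI2)
  show "ring (psigma_poly \<sigma> m)"
    using cring_psigma_poly by (rule cring.axioms)
  show "ring B"
    using cring_monoid_algebra[OF S_0 S_add] by (rule cring.axioms)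
  show "\<Phi> \<in> ring_hom (psigma_poly \<sigma> m) B"
    using \<Phi>_single[of 0 1] keys_\<Phi>
    by (auto simp: ring_hom_def psigma_poly_simps monoid_algebra_simps \<Phi>_add \<Phi>_mult)
qed

lemma S_preimage:
  assumes "w \<in> S"
  obtains u where "u \<in> Px_pow m" "w = expo u" "coef u \<noteq> 0"
  using assms by (auto simp: S_def)

lemma \<Phi>_terms: "\<Phi> ` terms (psigma_poly \<sigma> m) = terms B"
proof (intro subset_antisym subsetI)
  fix x assume "x \<in> \<Phi> ` terms (psigma_poly \<sigma> m)"
  then obtain u c where uc: "u \<in> Px_pow m" "x = Poly_Mapping.single (expo u) (c * coef u)"
    by (auto simp: psigma_poly_simps \<Phi>_single)
  show "x \<in> terms B"
  proof (cases "coef u = 0")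
    case True
    \<comment> \<open>\<open>expo u\<close> may lie outside S here, so the zero term is written with
      the exponent 0 instead.\<close>
    then have "x = Poly_Mapping.single 0 0"
      using uc by simp
    then show ?thesis
      unfolding monoid_algebra_simps using S_0 by blast
  next
    case False
    then have "expo u \<in> S"
      using uc by (auto simp: S_def)
    then show ?thesis
      using uc by (auto simp: monoid_algebra_simps)
  qed
next
  fix x assume "x \<in> terms B"
  then obtain w c where w: "w \<in> S" "x = Poly_Mapping.single w c"
    by (auto simp: monoid_algebra_simps)
  obtain u where u: "u \<in> Px_pow m" "w = expo u" "coef u \<noteq> 0"
    using w(1) by (rule S_preimage)
  \<comment> \<open>Among the exponents over w, u was chosen with a nonzero coefficient so that it
    can be divided out.\<close>
  then have "x = \<Phi> (Poly_Mapping.single u (c / coef u))"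
    using w by (simp add: \<Phi>_single)
  then show "x \<in> \<Phi> ` terms (psigma_poly \<sigma> m)"
    using u by (auto simp: psigma_poly_simps)
qed

lemma \<Phi>_surj: "\<Phi> ` carrier (psigma_poly \<sigma> m) = carrier B"
proof (intro subset_antisym subsetI)
  fix x assume "x \<in> carrier B"
  then have "Poly_Mapping.keys x \<subseteq> S"
    by (simp add: monoid_algebra_simps)
  then show "x \<in> \<Phi> ` carrier (psigma_poly \<sigma> m)"
  proof (induction x rule: keys_subset_induct)
    case zero
    have "\<Phi> 0 = 0" by (simp add: \<Phi>_def)
    then show ?case
      by (intro image_eqI[of _ _ 0]) (auto simp: psigma_poly_simps(1))
  next
    case (single w c)
    then have "Poly_Mapping.single w c \<in> \<Phi> ` terms (psigma_poly \<sigma> m)"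
      unfolding \<Phi>_terms by (auto simp: monoid_algebra_simps)
    then show ?case
      by (auto simp: psigma_poly_simps)
  next
    case (add f g)
    then obtain f' g' where "f' \<in> carrier (psigma_poly \<sigma> m)" "g' \<in> carrier (psigma_poly \<sigma> m)"
      "f = \<Phi> f'" "g = \<Phi> g'" by blast
    then show ?case
      by (intro image_eqI[of _ _ "f' + g'"]) (auto simp: \<Phi>_add psigma_poly_simps(1) keys_add_subset)
  qed
qed (use keys_\<Phi> in \<open>auto simp: psigma_poly_simps monoid_algebra_simps\<close>)

lemma \<Phi>_sig:
  assumes "Poly_Mapping.keys f \<subseteq> Px_pow m"
  shows "\<Phi> (sig (psigma_poly \<sigma> m) f) = sig B (\<Phi> f)"
  using assms
proof (induction f rule: keys_subset_induct)
  case zero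
  then show ?case
    by (simp add: psigma_poly_sig[OF \<sigma>] \<Phi>_def monoid_algebra_simps)
next
  case (single u c)
  then show ?case
    using sigma_field_simps[OF \<sigma>]
    by (simp add: psigma_poly_sig[OF \<sigma>] \<Phi>_single monoid_algebra_simps push_single expo_scale coef_x)
next
  case (add f g)
  have "push (Zx_scale [:0, 1:]) (\<lambda>_. \<sigma>) (x + y) =
      push (Zx_scale [:0, 1:]) (\<lambda>_. \<sigma>) x + push (Zx_scale [:0, 1:]) (\<lambda>_. \<sigma>) y" for x y
    by (rule push_add) (use sigma_field_simps[OF \<sigma>] in auto)
  then show ?case
    using add by (simp add: psigma_poly_sig[OF \<sigma>] \<Phi>_add monoid_algebra_simps)
qed

lemma psigma_iso_\<Phi>:
  "psigma_iso (psigma_quotient (psigma_poly \<sigma> m) (a_kernel (psigma_poly \<sigma> m) B \<Phi>)) B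
     (\<lambda>C. the_elem (\<Phi> ` C))"
proof (rule psigma_iso_quotient[OF \<Phi>_ring_hom \<Phi>_surj])
  show "sig (psigma_poly \<sigma> m) f \<in> carrier (psigma_poly \<sigma> m)" "\<Phi> (sig (psigma_poly \<sigma> m) f) = sig B (\<Phi> f)"
    if "f \<in> carrier (psigma_poly \<sigma> m)" for f
    using that psigma_poly_sig(1)[OF \<sigma>] \<Phi>_sig by (auto simp: psigma_poly_simps(1))
  show "smap (psigma_poly \<sigma> m) c \<in> carrier (psigma_poly \<sigma> m)" "\<Phi> (smap (psigma_poly \<sigma> m) c) = smap B c" for c
    by (simp_all add: psigma_poly_simps(1,6) monoid_algebra_simps(6) \<Phi>_single)
  show "terms (psigma_poly \<sigma> m) \<subseteq> carrier (psigma_poly \<sigma> m)"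
    by (auto simp: psigma_poly_simps(1,8) split: if_splits)
qed (rule \<Phi>_terms)

end

section \<open>Functions vanishing on the torus\<close>

lemma comorphism_eq_vanishing_ideal:
  assumes "affine_variety \<sigma> m V" "affine_variety \<sigma> n T"
    and f: "f \<in> carrier (psigma_poly \<sigma> m)"
    and s: "\<And>K b. b \<in> T K \<Longrightarrow> eval_tuple m s K b \<in> V K"
    and 0: "\<And>K b. b \<in> T K \<Longrightarrow> eval_psigma K (eval_tuple m s K b) f = \<zero>\<^bsub>K\<^esub>"
  shows "comorphism \<sigma> n T m s (affine_variety.cls \<sigma> m V f) = vanishing_ideal \<sigma> n T"
proof -
  interpret V: affine_variety \<sigma> m V by fact
  interpret T: affine_variety \<sigma> n T by fact
  have z: "eval_psigma K b \<zero>\<^bsub>T.R\<^esub> = \<zero>\<^bsub>K\<^esub>" if "b \<in> T K" for K b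
    using ring_hom_cring.hom_zero[OF T.eval_point_hom[OF that]] .
  show ?thesis
    unfolding comorphism_def
  \<comment> \<open>\<open>comorphism\<close> is a definite description. The zero class, which as a
    set is the vanishing ideal itself, satisfies it, and \<open>T.cls_eq_iff\<close> leaves no other
    candidate.\<close>
  proof (rule the_equality)
    have "vanishing_ideal \<sigma> n T \<in> carrier (coord_ring \<sigma> n T)"
      unfolding T.carrier_coord_ring using imageI[OF T.R.zero_closed, of T.cls] by (simp add: T.cls_zero)
    moreover have "eval_coord K b (vanishing_ideal \<sigma> n T) = eval_coord K (eval_tuple m s K b) (V.cls f)"
      if "b \<in> T K" for K b
      using T.eval_coord_cls[OF that T.R.zero_closed] V.eval_coord_cls[OF s[OF that] f] 0[OF that] z[OF that]
      unfolding T.cls_zero by simp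
    ultimately show "vanishing_ideal \<sigma> n T \<in> carrier (coord_ring \<sigma> n T) \<and>
        (\<forall>K. sigma_field_ext \<sigma> K \<longrightarrow> (\<forall>b\<in>T K. eval_coord K b (vanishing_ideal \<sigma> n T) =
           eval_coord K (eval_tuple m s K b) (V.cls f)))" by blast
  next
    fix D assume D: "D \<in> carrier (coord_ring \<sigma> n T) \<and>
        (\<forall>K. sigma_field_ext \<sigma> K \<longrightarrow> (\<forall>b\<in>T K. eval_coord K b D = eval_coord K (eval_tuple m s K b) (V.cls f)))"
    then obtain g where g: "g \<in> carrier T.R" "D = T.cls g"
      by (auto simp: T.carrier_coord_ring)
    have "eval_psigma K b g = eval_psigma K b \<zero>\<^bsub>T.R\<^esub>" if b: "b \<in> T K" for K b
    proof -
      have "eval_coord K b D = eval_coord K (eval_tuple m s K b) (V.cls f)"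
        using D b T.point_ext[OF b] by blast
      then show ?thesis
        using T.eval_coord_cls[OF b g(1)] V.eval_coord_cls[OF s[OF b] f] 0[OF b] z[OF b] g(2) by simp
    qed
    then have "T.cls g = T.cls \<zero>\<^bsub>T.R\<^esub>"
      using T.cls_eq_iff[OF g(1) T.R.zero_closed] by blast
    then show "D = vanishing_ideal \<sigma> n T"
      unfolding g(2) T.cls_zero .
  qed
qed

text \<open>The image of the spectrum of T is open and, thanks to the point
  \<open>b\<^sub>0\<close>, nonempty; so by irreducibility only the primes coming from T have to be
  inspected.\<close>

lemma vanishing_on_torus:
  assumes "affine_variety \<sigma> m V" "affine_variety \<sigma> n T"
    and irr: "irreducible_space (psigma_space \<sigma> m V)"
    and s: "open_inclusion \<sigma> n T m V s"
    and ne: "b\<^sub>0 \<in> T K\<^sub>0"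
    and f: "f \<in> carrier (psigma_poly \<sigma> m)"
    and 0: "\<And>K b. b \<in> T K \<Longrightarrow> eval_psigma K (eval_tuple m s K b) f = \<zero>\<^bsub>K\<^esub>"
  shows "f \<in> vanishing_ideal \<sigma> m V"
proof -
  interpret V: affine_variety \<sigma> m V by fact
  interpret T: affine_variety \<sigma> n T by fact
  have sV: "eval_tuple m s K b \<in> V K" if "b \<in> T K" for K b
    using s that T.point_ext[OF that] by (auto simp: open_inclusion_def psigma_morphism_def)
  show ?thesis
  proof (rule V.vanishing_on_open[OF irr])
    show "openin (psigma_space \<sigma> m V) (spectrum_map \<sigma> n T m V s ` topspace (psigma_space \<sigma> n T))"
      using s by (simp add: open_inclusion_def)
    show "spectrum_map \<sigma> n T m V s ` topspace (psigma_space \<sigma> n T) \<noteq> {}"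
      unfolding T.topspace_space using T.point_in_spectrum(1)[OF ne] by blast
    show "f \<in> V.preim p" if p: "p \<in> spectrum_map \<sigma> n T m V s ` topspace (psigma_space \<sigma> n T)" for p
    proof -
      \<comment> \<open>The prime p is pulled back from a prime q of k{T}. The pullback of f to T is
        the zero class, which every prime contains.\<close>
      obtain q where q: "q \<in> psigma_spectrum \<sigma> n T" "p = spectrum_map \<sigma> n T m V s q"
        using p by (auto simp: T.topspace_space)
      have "ideal (T.preim q) T.R"
        using T.preim_primeideal[OF q(1)] by (rule primeideal.axioms)
      then have "\<zero>\<^bsub>T.R\<^esub> \<in> T.preim q"
        by (intro additive_subgroup.zero_closed ideal.axioms)
      then have "T.cls \<zero>\<^bsub>T.R\<^esub> \<in> q"
        unfolding T.preim_def by blast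
      then have "vanishing_ideal \<sigma> n T \<in> q"
        unfolding T.cls_zero .
      then have "comorphism \<sigma> n T m s (V.cls f) \<in> q"
        using comorphism_eq_vanishing_ideal[OF assms(1,2) f sV 0] by simp
      then show ?thesis
        using f by (simp add: V.preim_def q(2) spectrum_map_def V.carrier_coord_ring)
    qed
  qed (rule f)
qed

text \<open>Distinct exponents stay distinct, so the coefficient at \<open>e u\<close> is still the
  one at u.\<close>

lemma push_inj_eq_0:
  fixes f :: "'a \<Rightarrow>\<^sub>0 'k::comm_monoid_add"
  assumes e: "inj_on e M" and f: "Poly_Mapping.keys f \<subseteq> M" and 0: "push e (\<lambda>_ c. c) f = 0"
  shows "f = 0"
proof (rule poly_mapping_eqI)
  fix u
  show "Poly_Mapping.lookup f u = Poly_Mapping.lookup 0 u"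
  proof (rule ccontr)
    assume "Poly_Mapping.lookup f u \<noteq> Poly_Mapping.lookup 0 u"
    then have u: "u \<in> Poly_Mapping.keys f"
      by (simp add: in_keys_iff)
    have "0 = Poly_Mapping.lookup (push e (\<lambda>_ c. c) f) (e u)"
      by (simp add: 0)
    also have "\<dots> = (\<Sum>u'\<in>Poly_Mapping.keys f. Poly_Mapping.lookup f u' when e u' = e u)"
      by (simp add: push_def lookup_sum lookup_single)
    also have "\<dots> = (\<Sum>u'\<in>Poly_Mapping.keys f. Poly_Mapping.lookup f u' when u' = u)"
      using e f u by (intro sum.cong refl when_cong) (auto dest: inj_onD)
    also have "\<dots> = Poly_Mapping.lookup f u"
      using u by (simp add: when_def sum.delta)
    finally show False
      using u by (simp add: in_keys_iff)
  qed
qed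

theorem theorem4p17:
  fixes \<sigma> :: "'k::field_char_0 \<Rightarrow> 'k"
    and V T :: "('u, 'k) point_functor"
    and m n :: nat
    and scale :: "int poly \<Rightarrow> 'm::ab_group_add \<Rightarrow> 'm"
    and M :: "'m set"
    and \<theta> :: "('m \<Rightarrow>\<^sub>0 'k) \<Rightarrow> ((nat \<Rightarrow>\<^sub>0 int poly) \<Rightarrow>\<^sub>0 'k) set"
    and s t :: "nat \<Rightarrow> (nat \<Rightarrow>\<^sub>0 int poly) \<Rightarrow>\<^sub>0 'k"
  assumes "sigma_field \<sigma>"
    and "affine_psigma_variety \<sigma> m V"
    and "irreducible_space (psigma_space \<sigma> m V)"
    and "sigma_torus \<sigma> n T scale M \<theta>"
    and "open_inclusion \<sigma> n T m V s"
    and "sigma_algebraic_action \<sigma> n T M \<theta> m V t"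
    and "extends_translation \<sigma> n T M \<theta> m s t"
  shows "\<exists>N S. affine_Px_semimodule N S \<and>
           (\<exists>h. psigma_iso (coord_ring \<sigma> m V) (monoid_algebra \<sigma> Zx_scale S) h)"
proof -
  have VT: "affine_variety \<sigma> m V" "affine_variety \<sigma> n T"
    using assms(1,2,4) by (auto simp: affine_variety_def sigma_torus_def)
  interpret V: affine_variety \<sigma> m V by fact
  interpret T: affine_variety \<sigma> n T by fact
  have lattice: "Zx_lattice scale M" and iso: "psigma_iso (monoid_algebra \<sigma> scale M) (coord_ring \<sigma> n T) \<theta>"
    using assms(4) by (auto simp: sigma_torus_def)
  interpret lat: Modules.module scale
    using lattice by (simp add: Zx_lattice_def)
  have M: "lat.subspace M"
    using lattice by (simp add: Zx_lattice_def)
  obtain N e where e: "inj_on e M" "e ` M \<subseteq> Zx_pow N" "\<And>u v. u \<in> M \<Longrightarrow> v \<in> M \<Longrightarrow> e (u + v) = e u + e v"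
    "\<And>g u. u \<in> M \<Longrightarrow> e (scale g u) = Zx_scale g (e u)"
    using lattice unfolding Zx_lattice_def by blast
  define A where "A = monoid_algebra \<sigma> scale M"
  interpret A: cring A
    unfolding A_def using M by (intro cring_monoid_algebra) (auto simp: lat.subspace_0 lat.subspace_add)
  have carrierA: "carrier A = {f. Poly_Mapping.keys f \<subseteq> M}"
    by (simp add: A_def monoid_algebra_simps)
  have \<theta>: "psigma_hom A (coord_ring \<sigma> n T) \<theta>" and bij: "bij_betw \<theta> (carrier A) (carrier (coord_ring \<sigma> n T))"
    and inv: "psigma_hom (coord_ring \<sigma> n T) A (inv_into (carrier A) \<theta>)"
    using iso by (auto simp: psigma_iso_def A_def)
  have \<theta>_hom: "\<theta> \<in> ring_hom A (coord_ring \<sigma> n T)"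
    using \<theta> by (simp add: psigma_hom_def)
  have \<theta>_sig: "\<theta> (sig A f) = sig (coord_ring \<sigma> n T) (\<theta> f)" if "f \<in> carrier A" for f
    using \<theta> that by (simp add: psigma_hom_def)
  have \<theta>_smap: "\<theta> (smap A c) = smap (coord_ring \<sigma> n T) c" for c
    using \<theta> by (simp add: psigma_hom_def)

  \<comment> \<open>\<open>s i\<close> is a term and the inverse of \<theta> preserves terms too,
    which is why a single term arises. If d_i = 0, this does not determine w_i, but S ignores such
    indices.\<close>
  have "\<exists>w d. w \<in> M \<and> \<theta> (Poly_Mapping.single w d) = T.cls (s i)" if "i < m" for i
  proof -
    have si: "s i \<in> terms T.R"
      using assms(5) that by (simp add: open_inclusion_def psigma_morphism_def)
    then have "T.cls (s i) \<in> terms (coord_ring \<sigma> n T)"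
      by (auto simp: coord_ring_def psigma_quotient_simps T.cls_def)
    then have "inv_into (carrier A) \<theta> (T.cls (s i)) \<in> terms A"
      using inv by (auto simp: psigma_hom_def)
    then obtain w d where wd: "w \<in> M" "inv_into (carrier A) \<theta> (T.cls (s i)) = Poly_Mapping.single w d"
      by (auto simp: A_def monoid_algebra_simps)
    have "s i \<in> carrier T.R"
      using si by (auto simp: psigma_poly_simps(1,8) split: if_splits)
    then have "T.cls (s i) \<in> \<theta> ` carrier A"
      using bij by (auto simp: bij_betw_def T.carrier_coord_ring)
    then have "\<theta> (Poly_Mapping.single w d) = T.cls (s i)"
      using f_inv_into_f wd(2) by metis
    then show ?thesis using wd(1) by blast
  qed
  then obtain w d where w: "\<And>i. i < m \<Longrightarrow> w i \<in> M"
    and wd: "\<And>i. i < m \<Longrightarrow> \<theta> (Poly_Mapping.single (w i) (d i)) = T.cls (s i)"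
    by metis

  \<comment> \<open>Evaluation at b, read through \<theta>, is a homomorphism from k[M] to K, so the
    power formula applies at every point of T.\<close>
  have point: "character_point K \<sigma> scale M (\<lambda>g. eval_coord K b (\<theta> g))" if b: "b \<in> T K" for K b
  proof -
    interpret K: sigma_ext K \<sigma> using b by (rule T.point_sigma_ext)
    show ?thesis
    proof
      show "sigma_field \<sigma>" by fact
      show "lat.subspace M" by fact
      have "eval_coord K b \<circ> \<theta> \<in> ring_hom A K"
        using \<theta>_hom T.eval_coord_hom[OF b] by (rule ring_hom_trans)
      then show "(\<lambda>g. eval_coord K b (\<theta> g)) \<in> ring_hom (monoid_algebra \<sigma> scale M) K"
        by (simp add: A_def o_def)
      show "eval_coord K b (\<theta> (sig (monoid_algebra \<sigma> scale M) f)) = sig K (eval_coord K b (\<theta> f))"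
        if "Poly_Mapping.keys f \<subseteq> M" for f
      proof -
        have "f \<in> carrier A"
          using that by (simp add: carrierA)
        then show ?thesis
          using \<theta>_sig[of f] T.eval_coord_sig[OF b ring_hom_closed[OF \<theta>_hom, of f]] unfolding A_def by simp
      qed
      show "eval_coord K b (\<theta> (Poly_Mapping.single 0 c)) = smap K c" for c
        using \<theta>_smap[of c] T.eval_coord_smap[OF b, of c] by (simp add: A_def monoid_algebra_simps)
    qed
  qed

  \<comment> \<open>\<Psi>, defined next, is the map k{y_1,...,y_m} -> k[M] dual to the inclusion,
    with exponents still in M.\<close>
  define E where "E u = (\<Sum>i<m. scale (Poly_Mapping.lookup u i) (w i))" for u :: "nat \<Rightarrow>\<^sub>0 int poly"
  define \<Psi> where "\<Psi> = push E (\<lambda>u c. c * eval_mono (base_field \<sigma>) d u)"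
  have E: "E u \<in> M" for u
    unfolding E_def using w M by (intro lat.subspace_sum lat.subspace_scale) auto
  have keys_\<Psi>: "\<Psi> f \<in> carrier A" for f
    unfolding carrierA \<Psi>_def using E by (intro CollectI keys_push[of f UNIV]) auto
  have s_carrier: "s i \<in> carrier T.R" if "i < m" for i
    using assms(5) that by (auto simp: open_inclusion_def psigma_morphism_def psigma_poly_simps(1,8) split: if_splits)
  have eval: "eval_psigma K (eval_tuple m s K b) f = eval_coord K b (\<theta> (\<Psi> f))"
    if b: "b \<in> T K" and f: "f \<in> carrier V.R" for K b f
    unfolding \<Psi>_def E_def
  proof (rule character_point.eval_psigma_character[OF point[OF b] w])
    show "eval_tuple m s K b i = eval_coord K b (\<theta> (Poly_Mapping.single (w i) (d i)))" if "i < m" for i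
      using that s_carrier[OF that] T.eval_coord_cls[OF b] by (simp add: eval_tuple_def wd)
    show "Poly_Mapping.keys f \<subseteq> Px_pow m"
      using f by (simp add: psigma_poly_simps(1))
  qed
  have \<theta>_0: "\<theta> \<zero>\<^bsub>A\<^esub> = T.cls \<zero>\<^bsub>T.R\<^esub>"
    using \<theta>_smap[of 0]
    by (simp add: A_def coord_ring_def psigma_quotient_simps monoid_algebra_simps(5,6) psigma_poly_simps(5,6) T.cls_def)
  \<comment> \<open>\<theta> is injective and points separate classes.\<close>
  have eval_0: "(\<forall>K. \<forall>b\<in>T K. eval_coord K b (\<theta> g) = \<zero>\<^bsub>K\<^esub>) \<longleftrightarrow> g = 0" if g: "g \<in> carrier A" for g
  proof -
    obtain f where f: "f \<in> carrier T.R" "\<theta> g = T.cls f"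
      using ring_hom_closed[OF \<theta>_hom g] by (auto simp: T.carrier_coord_ring)
    have z: "eval_psigma K b \<zero>\<^bsub>T.R\<^esub> = \<zero>\<^bsub>K\<^esub>" if "b \<in> T K" for K b
      using ring_hom_cring.hom_zero[OF T.eval_point_hom[OF that]] .
    have "(\<forall>K. \<forall>b\<in>T K. eval_coord K b (\<theta> g) = \<zero>\<^bsub>K\<^esub>) \<longleftrightarrow> \<theta> g = \<theta> \<zero>\<^bsub>A\<^esub>"
      unfolding \<theta>_0 f(2) T.cls_eq_iff[OF f(1) T.R.zero_closed] using T.eval_coord_cls[OF _ f(1)] z by auto
    also have "\<dots> \<longleftrightarrow> g = \<zero>\<^bsub>A\<^esub>"
      using inj_on_eq_iff[OF bij_betw_imp_inj_on[OF bij] g A.zero_closed] .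
    finally show ?thesis
      by (simp add: A_def monoid_algebra_simps)
  qed
  \<comment> \<open>As 1 is nonzero in k[M], it takes a nonzero value somewhere; in particular T has
    a point.\<close>
  obtain K\<^sub>0 b\<^sub>0 where b\<^sub>0: "b\<^sub>0 \<in> T K\<^sub>0"
    using eval_0[OF A.one_closed] by (auto simp: A_def monoid_algebra_simps)
  \<comment> \<open>\<open>vanishing_on_torus\<close> gives the direction from left to right; the
    converse holds because points of T are sent to points of X.\<close>
  have kernel: "\<Psi> f = 0 \<longleftrightarrow> f \<in> V.I" if f: "f \<in> carrier V.R" for f
  proof -
    have sV: "eval_tuple m s K b \<in> V K" if "b \<in> T K" for K b
      using assms(5) that T.point_ext[OF that] by (auto simp: open_inclusion_def psigma_morphism_def)
    have "\<Psi> f = 0 \<longleftrightarrow> (\<forall>K. \<forall>b\<in>T K. eval_psigma K (eval_tuple m s K b) f = \<zero>\<^bsub>K\<^esub>)"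
      using eval_0[OF keys_\<Psi>, of f] eval[OF _ f] by auto
    also have "\<dots> \<longleftrightarrow> f \<in> V.I"
      using vanishing_on_torus[OF VT assms(3,5) b\<^sub>0 f] sV by (auto simp: V.vanishing_iff)
    finally show ?thesis .
  qed

  interpret tm: toric_map \<sigma> m N "\<lambda>i. e (w i)" d
    using assms(1) e(2) w by unfold_locales auto
  have e_0: "e 0 = 0"
    using e(3)[of 0 0] M by (simp add: lat.subspace_0)
  \<comment> \<open>e is additive on M only, so the partial sums have to be kept in M.\<close>
  have e_sum: "e (\<Sum>i\<in>J. x i) = (\<Sum>i\<in>J. e (x i))" if "finite J" "\<And>i. i \<in> J \<Longrightarrow> x i \<in> M" for J and x :: "nat \<Rightarrow> 'm"
    using that
  proof (induction J rule: finite_induct)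
    case (insert j J)
    then have "sum x J \<in> M"
      using M by (intro lat.subspace_sum) auto
    then show ?case
      using insert e(3)[of "x j" "sum x J"] by simp
  qed (simp add: e_0)
  have expo: "tm.expo u = e (E u)" for u
    unfolding tm.expo_def E_def using w M e(4) by (subst e_sum) (auto intro: lat.subspace_scale)
  \<comment> \<open>\<open>tm.\<Phi>\<close> is \<Psi> followed by relabelling exponents through e.
    As e is injective on M, both have the same kernel.\<close>
  have "tm.\<Phi> f = push e (\<lambda>_ c. c) (\<Psi> f)" if "Poly_Mapping.keys f \<subseteq> Px_pow m" for f
    using that
  proof (induction f rule: keys_subset_induct)
    case zero
    then show ?case by (simp add: tm.\<Phi>_def \<Psi>_def)
  next
    case (single u c)
    then show ?case by (simp add: tm.\<Phi>_single expo \<Psi>_def push_single tm.coef_def)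
  next
    case (add f g)
    have "\<Psi> (f + g) = \<Psi> f + \<Psi> g"
      unfolding \<Psi>_def by (rule push_add) (auto simp: distrib_right)
    moreover have "push e (\<lambda>_ c. c) (x + y) = push e (\<lambda>_ c. c) x + push e (\<lambda>_ c. c) y" for x y :: "'m \<Rightarrow>\<^sub>0 'k"
      by (rule push_add) auto
    ultimately show ?case
      using add by (simp add: tm.\<Phi>_add)
  qed
  then have "tm.\<Phi> f = 0 \<longleftrightarrow> f \<in> V.I" if "f \<in> carrier V.R" for f
    using that kernel[OF that] push_inj_eq_0[OF e(1), of "\<Psi> f"] keys_\<Psi>[of f]
    by (auto simp: psigma_poly_simps(1) carrierA)
  \<comment> \<open>The kernel is the vanishing ideal itself, so the quotient by it is literally
    \<open>coord_ring \<sigma> m V\<close>.\<close>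
  then have "a_kernel V.R tm.B tm.\<Phi> = V.I"
    using V.I.a_subset by (auto simp: a_kernel_def' monoid_algebra_simps)
  then have "psigma_iso (coord_ring \<sigma> m V) tm.B (\<lambda>C. the_elem (tm.\<Phi> ` C))"
    using tm.psigma_iso_\<Phi> by (simp add: coord_ring_def)
  then show ?thesis
    using tm.affine_S by blast
qed

end
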